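(* Let $(M,\phi,\xi,\eta,g)$ be a $(2n+1)$-dimensional Kenmotsu manifold, let $a>0$ be a constant, and let $(\overline{\phi},\overline{\xi},\overline{\eta},\overline{g})$ be the $D$-homothetically deformed structure on $M$. If $(V,\overline{\lambda})$ defines an almost Riemann soliton in $(M,\overline{g})$ with $V$ solenoidal, then $$\overline{\lambda}=\frac{2n-1}{2n}\xi(\eta(V))-\frac{1}{a^2},$$ for all vector fields $X,Y$ on $M$ $$\begin{aligned}\mathrm{Ric}(X,Y)={}&[(2n-1)a\,\xi(\eta(V))-2n]\,g(X,Y)+(2n-1)a(a-1)\,\xi(\eta(V))\,\eta(X)\eta(Y)\\&-\frac{(2n-1)a}{2}[g(\nabla_XV,Y)+g(\nabla_YV,X)]\\&-\frac{(2n-1)a(a-1)}{2}\{\eta(X)[\eta(\nabla_YV)+g(Y,V)]+\eta(Y)[\eta(\nabla_XV)+g(X,V)]-2\eta(X)\eta(Y)\eta(V)\},\end{aligned}$$ and $$\mathrm{scal}=(2n+1)[(2n-1)a\,\xi(\eta(V))-2n],$$ where $\nabla$, $\mathrm{Ric}$ and $\mathrm{scal}$ are the Levi-Civita connection, the Ricci tensor and the scalar curvature of $g$.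
   Context: An almost contact metric manifold $(M,\phi,\xi,\eta,g)$ is an odd-dimensional Riemannian manifold $(M,g)$, here of dimension $2n+1$ with $n\ge 1$, together with a $(1,1)$-tensor field $\phi$, a vector field $\xi$ (the Reeb vector field) and a $1$-form $\eta$ such that $\phi^2=-I+\eta\otimes\xi$, $\eta(\xi)=1$, $\eta=g(\xi,\cdot)$ and $g(\phi X,\phi Y)=g(X,Y)-\eta(X)\eta(Y)$. It is a Kenmotsu manifold if the Levi-Civita connection $\nabla$ of $g$ satisfies $(\nabla_X\phi)Y=g(\phi X,Y)\xi-\eta(Y)\phi X$ for all vector fields $X,Y$. For a constant $a>0$, the $D$-homothetically deformed structure is $\overline{\phi}=\phi$, $\overline{\xi}=\frac{1}{a}\xi$, $\overline{\eta}=a\eta$, $\overline{g}=ag+a(a-1)\eta\otimes\eta$. For a Riemannian metric $h$, a nowhere-vanishing vector field $V$ and a smooth function $\lambda$ on $M$, the pair $(V,\lambda)$ defines an almost Riemann soliton in $(M,h)$ if $\frac12\mathcal{L}_Vh\odot h+R_h=\frac{\lambda}{2}\,h\odot h$. Here $\mathcal{L}$ is the Lie derivative; $R_h(X,Y,Z,W)=h(R_h(X,Y)Z,W)$ with $R_h(X,Y)Z=\nabla^h_X\nabla^h_YZ-\nabla^h_Y\nabla^h_XZ-\nabla^h_{[X,Y]}Z$; and for $(0,2)$-tensors $(T_1\odot T_2)(X,Y,Z,W)=T_1(X,W)T_2(Y,Z)+T_1(Y,Z)T_2(X,W)-T_1(X,Z)T_2(Y,W)-T_1(Y,W)T_2(X,Z)$.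 A vector field is solenoidal if it is divergence-free; the divergences with respect to $g$ and $\overline{g}$ coincide. *)

theory Defs
  imports "HOL-Analysis.Analysis" "HOL-Library.Function_Algebras"
begin

text \<open>Pointwise scalar multiplication on functions.  Together with the pointwise addition of
  Function_Algebras it makes tangent vectors and vector fields elements of real vector spaces.\<close>

instantiation "fun" :: (type, real_vector) real_vector
begin

definition scaleR_fun :: "real \<Rightarrow> ('a \<Rightarrow> 'b) \<Rightarrow> 'a \<Rightarrow> 'b"
  where "scaleR_fun r f = (\<lambda>x. r *\<^sub>R f x)"

instance
  by standard (simp_all add: scaleR_fun_def fun_eq_iff scaleR_add_right scaleR_add_left)

end


section \<open>Smooth manifolds\<close>

primrec k_times_differentiable ::
    "nat \<Rightarrow> 'a::real_normed_vector set \<Rightarrow> ('a \<Rightarrow> 'b::real_normed_vector) \<Rightarrow> bool"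
  where
    "k_times_differentiable 0 S f \<longleftrightarrow> continuous_on S f"
  | "k_times_differentiable (Suc k) S f \<longleftrightarrow>
       (\<forall>x\<in>S. f differentiable (at x)) \<and>
       (\<forall>v. k_times_differentiable k S (\<lambda>x. frechet_derivative f (at x) v))"

text \<open>This is the usual notion for open \<open>S\<close>, the only case in which it is used.\<close>

definition C_infinity_on ::
    "'a::real_normed_vector set \<Rightarrow> ('a \<Rightarrow> 'b::real_normed_vector) \<Rightarrow> bool"
  where "C_infinity_on S f \<longleftrightarrow> (\<forall>k. k_times_differentiable k S f)"

text \<open>The points of the manifold are all the elements of a (second countable Hausdorff) type.
  A chart is a pair \<open>(U, c)\<close> of an open set and a map that matters only on \<open>U\<close>;
  \<open>inv_into U c\<close> is the local parametrization.\<close>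

type_synonym ('m, 'e) chart = "'m set \<times> ('m \<Rightarrow> 'e)"

definition smooth_atlas ::
    "('m::{t2_space,second_countable_topology}, 'e::euclidean_space) chart set \<Rightarrow> bool"
  where "smooth_atlas A \<longleftrightarrow>
    (\<Union>(U, c)\<in>A. U) = UNIV \<and>
    (\<forall>(U, c)\<in>A. open U \<and> open (c ` U) \<and> homeomorphism U (c ` U) c (inv_into U c)) \<and>
    (\<forall>(U, c)\<in>A. \<forall>(U', c')\<in>A. C_infinity_on (c ` (U \<inter> U')) (c' \<circ> inv_into U c))"

definition smooth_fun ::
    "('m::{t2_space,second_countable_topology}, 'e::euclidean_space) chart set
     \<Rightarrow> ('m \<Rightarrow> real) \<Rightarrow> bool"
  where "smooth_fun A f \<longleftrightarrow> (\<forall>(U, c)\<in>A. C_infinity_on (c ` U) (f \<circ> inv_into U c))"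

text \<open>A tangent vector is an operator on smooth functions.  Since functions are total it has to
  be given some value on non-smooth functions as well; this is always 0, so that equality of
  tangent vectors is equality in HOL.\<close>

type_synonym 'm tangent_vector = "('m \<Rightarrow> real) \<Rightarrow> real"
type_synonym 'm vfield = "'m \<Rightarrow> 'm tangent_vector"

definition tangent_space ::
    "('m::{t2_space,second_countable_topology}, 'e::euclidean_space) chart set
     \<Rightarrow> 'm \<Rightarrow> 'm tangent_vector set"
  where "tangent_space A p = {v. \<exists>(U, c)\<in>A. p \<in> U \<and> (\<exists>u. \<forall>f. v f =
    (if smooth_fun A f then frechet_derivative (f \<circ> inv_into U c) (at (c p)) u else 0))}"

definition vector_field ::
    "('m::{t2_space,second_countable_topology}, 'e::euclidean_space) chart set
     \<Rightarrow> 'm vfield \<Rightarrow> bool"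
  where "vector_field A X \<longleftrightarrow>
    (\<forall>p. X p \<in> tangent_space A p) \<and>
    (\<forall>f. smooth_fun A f \<longrightarrow> smooth_fun A (\<lambda>p. X p f))"

definition lie_bracket :: "'m vfield \<Rightarrow> 'm vfield \<Rightarrow> 'm vfield"
  where "lie_bracket X Y = (\<lambda>p f. X p (\<lambda>q. Y q f) - Y p (\<lambda>q. X q f))"

definition linear_on_tangent_space ::
    "('m::{t2_space,second_countable_topology}, 'e::euclidean_space) chart set
     \<Rightarrow> 'm \<Rightarrow> ('m tangent_vector \<Rightarrow> 'b::real_vector) \<Rightarrow> bool"
  where "linear_on_tangent_space A p L \<longleftrightarrow>
    (\<forall>u\<in>tangent_space A p. \<forall>v\<in>tangent_space A p. L (u + v) = L u + L v) \<and>
    (\<forall>r. \<forall>u\<in>tangent_space A p. L (r *\<^sub>R u) = r *\<^sub>R L u)"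

text \<open>Tensor fields are families of multilinear maps on the tangent spaces; they are smooth if
  they take smooth vector fields to smooth objects.\<close>

definition one_form ::
    "('m::{t2_space,second_countable_topology}, 'e::euclidean_space) chart set
     \<Rightarrow> ('m \<Rightarrow> 'm tangent_vector \<Rightarrow> real) \<Rightarrow> bool"
  where "one_form A \<eta> \<longleftrightarrow>
    (\<forall>p. linear_on_tangent_space A p (\<eta> p)) \<and>
    (\<forall>X. vector_field A X \<longrightarrow> smooth_fun A (\<lambda>p. \<eta> p (X p)))"

definition tensor_field_1_1 ::
    "('m::{t2_space,second_countable_topology}, 'e::euclidean_space) chart set
     \<Rightarrow> ('m \<Rightarrow> 'm tangent_vector \<Rightarrow> 'm tangent_vector) \<Rightarrow> bool"
  where "tensor_field_1_1 A \<phi> \<longleftrightarrow>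
    (\<forall>p. linear_on_tangent_space A p (\<phi> p)) \<and>
    (\<forall>p. \<forall>u\<in>tangent_space A p. \<phi> p u \<in> tangent_space A p) \<and>
    (\<forall>X. vector_field A X \<longrightarrow> vector_field A (\<lambda>p. \<phi> p (X p)))"


section \<open>Riemannian geometry\<close>

type_synonym 'm metric_field = "'m \<Rightarrow> 'm tangent_vector \<Rightarrow> 'm tangent_vector \<Rightarrow> real"

definition riemannian_metric ::
    "('m::{t2_space,second_countable_topology}, 'e::euclidean_space) chart set
     \<Rightarrow> 'm metric_field \<Rightarrow> bool"
  where "riemannian_metric A g \<longleftrightarrow>
    (\<forall>p. \<forall>u\<in>tangent_space A p. linear_on_tangent_space A p (g p u)) \<and>
    (\<forall>p. \<forall>u\<in>tangent_space A p. \<forall>v\<in>tangent_space A p. g p u v = g p v u) \<and>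
    (\<forall>p. \<forall>u\<in>tangent_space A p. u \<noteq> 0 \<longrightarrow> g p u u > 0) \<and>
    (\<forall>X Y. vector_field A X \<longrightarrow> vector_field A Y \<longrightarrow> smooth_fun A (\<lambda>p. g p (X p) (Y p)))"

definition on_fields :: "'m metric_field \<Rightarrow> 'm vfield \<Rightarrow> 'm vfield \<Rightarrow> 'm \<Rightarrow> real"
  where "on_fields g X Y = (\<lambda>p. g p (X p) (Y p))"

definition affine_connection ::
    "('m::{t2_space,second_countable_topology}, 'e::euclidean_space) chart set
     \<Rightarrow> ('m vfield \<Rightarrow> 'm vfield \<Rightarrow> 'm vfield) \<Rightarrow> bool"
  where "affine_connection A D \<longleftrightarrow>
    (\<forall>X Y. vector_field A X \<longrightarrow> vector_field A Y \<longrightarrow> vector_field A (D X Y)) \<and>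
    (\<forall>X Y Z. vector_field A X \<longrightarrow> vector_field A Y \<longrightarrow> vector_field A Z \<longrightarrow>
       D (X + Y) Z = D X Z + D Y Z \<and> D X (Y + Z) = D X Y + D X Z) \<and>
    (\<forall>f X Y. smooth_fun A f \<longrightarrow> vector_field A X \<longrightarrow> vector_field A Y \<longrightarrow>
       D (\<lambda>p. f p *\<^sub>R X p) Y = (\<lambda>p. f p *\<^sub>R D X Y p) \<and>
       D X (\<lambda>p. f p *\<^sub>R Y p) = (\<lambda>p. X p f *\<^sub>R Y p + f p *\<^sub>R D X Y p))"

definition levi_civita_connection ::
    "('m::{t2_space,second_countable_topology}, 'e::euclidean_space) chart set
     \<Rightarrow> 'm metric_field \<Rightarrow> ('m vfield \<Rightarrow> 'm vfield \<Rightarrow> 'm vfield) \<Rightarrow> bool"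
  where "levi_civita_connection A g D \<longleftrightarrow>
    affine_connection A D \<and>
    (\<forall>X Y. vector_field A X \<longrightarrow> vector_field A Y \<longrightarrow> D X Y - D Y X = lie_bracket X Y) \<and>
    (\<forall>X Y Z. vector_field A X \<longrightarrow> vector_field A Y \<longrightarrow> vector_field A Z \<longrightarrow>
       (\<forall>p. X p (on_fields g Y Z) = on_fields g (D X Y) Z p + on_fields g Y (D X Z) p))"

definition curvature ::
    "('m vfield \<Rightarrow> 'm vfield \<Rightarrow> 'm vfield) \<Rightarrow> 'm vfield \<Rightarrow> 'm vfield \<Rightarrow> 'm vfield \<Rightarrow> 'm vfield"
  where "curvature D X Y Z = D X (D Y Z) - D Y (D X Z) - D (lie_bracket X Y) Z"

definition riemann_tensor ::
    "'m metric_field \<Rightarrow> ('m vfield \<Rightarrow> 'm vfield \<Rightarrow> 'm vfield)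
     \<Rightarrow> 'm vfield \<Rightarrow> 'm vfield \<Rightarrow> 'm vfield \<Rightarrow> 'm vfield \<Rightarrow> 'm \<Rightarrow> real"
  where "riemann_tensor g D X Y Z W = on_fields g (curvature D X Y Z) W"

definition lie_derivative_metric ::
    "'m vfield \<Rightarrow> 'm metric_field \<Rightarrow> 'm vfield \<Rightarrow> 'm vfield \<Rightarrow> 'm \<Rightarrow> real"
  where "lie_derivative_metric V g X Y = (\<lambda>p. V p (on_fields g X Y)
    - on_fields g (lie_bracket V X) Y p - on_fields g X (lie_bracket V Y) p)"

text \<open>Traces are taken over an orthonormal basis of the tangent space at \<open>p\<close>, extended to global
  smooth vector fields because the tensors to be traced are given on vector fields.  They are
  \<open>C\<^sup>\<infinity>\<close>-bilinear, so neither the basis nor its extension matters.  The vectors are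
  indexed by the standard basis of the model space merely to have the right number of them.\<close>

definition orthonormal_at ::
    "('m::{t2_space,second_countable_topology}, 'e::euclidean_space) chart set
     \<Rightarrow> 'm metric_field \<Rightarrow> 'm \<Rightarrow> ('e \<Rightarrow> 'm vfield) \<Rightarrow> bool"
  where "orthonormal_at A g p E \<longleftrightarrow>
    (\<forall>i\<in>Basis. vector_field A (E i)) \<and>
    (\<forall>i\<in>Basis. \<forall>j\<in>Basis. g p (E i p) (E j p) = (if i = j then 1 else 0))"

definition metric_trace ::
    "('m::{t2_space,second_countable_topology}, 'e::euclidean_space) chart set
     \<Rightarrow> 'm metric_field \<Rightarrow> ('m vfield \<Rightarrow> 'm vfield \<Rightarrow> 'm \<Rightarrow> real) \<Rightarrow> 'm \<Rightarrow> real"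
  where "metric_trace A g T p =
    (let E = (SOME E. orthonormal_at A g p E) in \<Sum>i\<in>Basis. T (E i) (E i) p)"

definition divergence ::
    "('m::{t2_space,second_countable_topology}, 'e::euclidean_space) chart set
     \<Rightarrow> 'm metric_field \<Rightarrow> ('m vfield \<Rightarrow> 'm vfield \<Rightarrow> 'm vfield) \<Rightarrow> 'm vfield \<Rightarrow> 'm \<Rightarrow> real"
  where "divergence A g D V = metric_trace A g (\<lambda>X W. on_fields g (D X V) W)"

definition solenoidal ::
    "('m::{t2_space,second_countable_topology}, 'e::euclidean_space) chart set
     \<Rightarrow> 'm metric_field \<Rightarrow> ('m vfield \<Rightarrow> 'm vfield \<Rightarrow> 'm vfield) \<Rightarrow> 'm vfield \<Rightarrow> bool"
  where "solenoidal A g D V \<longleftrightarrow> (\<forall>p. divergence A g D V p = 0)"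

definition ricci ::
    "('m::{t2_space,second_countable_topology}, 'e::euclidean_space) chart set
     \<Rightarrow> 'm metric_field \<Rightarrow> ('m vfield \<Rightarrow> 'm vfield \<Rightarrow> 'm vfield)
     \<Rightarrow> 'm vfield \<Rightarrow> 'm vfield \<Rightarrow> 'm \<Rightarrow> real"
  where "ricci A g D Y Z = metric_trace A g (\<lambda>X W. riemann_tensor g D X Y Z W)"

definition scalar_curvature ::
    "('m::{t2_space,second_countable_topology}, 'e::euclidean_space) chart set
     \<Rightarrow> 'm metric_field \<Rightarrow> ('m vfield \<Rightarrow> 'm vfield \<Rightarrow> 'm vfield) \<Rightarrow> 'm \<Rightarrow> real"
  where "scalar_curvature A g D = metric_trace A g (ricci A g D)"


section \<open>Kenmotsu manifolds and almost Riemann solitons\<close>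

text \<open>The predicates below take a connection \<open>D\<close> and require it to be the Levi-Civita
  connection of the metric, which is unique on vector fields.\<close>

definition almost_contact_metric ::
    "('m::{t2_space,second_countable_topology}, 'e::euclidean_space) chart set
     \<Rightarrow> ('m \<Rightarrow> 'm tangent_vector \<Rightarrow> 'm tangent_vector) \<Rightarrow> 'm vfield
     \<Rightarrow> ('m \<Rightarrow> 'm tangent_vector \<Rightarrow> real) \<Rightarrow> 'm metric_field \<Rightarrow> bool"
  where "almost_contact_metric A \<phi> \<xi> \<eta> g \<longleftrightarrow>
    smooth_atlas A \<and> odd DIM('e) \<and>
    riemannian_metric A g \<and> tensor_field_1_1 A \<phi> \<and> vector_field A \<xi> \<and> one_form A \<eta> \<and>
    (\<forall>p. \<eta> p (\<xi> p) = 1) \<and>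
    (\<forall>p. \<forall>u\<in>tangent_space A p.
       \<phi> p (\<phi> p u) = - u + \<eta> p u *\<^sub>R \<xi> p \<and>
       \<eta> p u = g p (\<xi> p) u) \<and>
    (\<forall>p. \<forall>u\<in>tangent_space A p. \<forall>v\<in>tangent_space A p.
       g p (\<phi> p u) (\<phi> p v) = g p u v - \<eta> p u * \<eta> p v)"

definition kenmotsu ::
    "('m::{t2_space,second_countable_topology}, 'e::euclidean_space) chart set
     \<Rightarrow> ('m \<Rightarrow> 'm tangent_vector \<Rightarrow> 'm tangent_vector) \<Rightarrow> 'm vfield
     \<Rightarrow> ('m \<Rightarrow> 'm tangent_vector \<Rightarrow> real) \<Rightarrow> 'm metric_field
     \<Rightarrow> ('m vfield \<Rightarrow> 'm vfield \<Rightarrow> 'm vfield) \<Rightarrow> bool"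
  where "kenmotsu A \<phi> \<xi> \<eta> g D \<longleftrightarrow>
    almost_contact_metric A \<phi> \<xi> \<eta> g \<and> levi_civita_connection A g D \<and>
    (\<forall>X Y. vector_field A X \<longrightarrow> vector_field A Y \<longrightarrow> (\<forall>p.
       D X (\<lambda>q. \<phi> q (Y q)) p - \<phi> p (D X Y p) =
         g p (\<phi> p (X p)) (Y p) *\<^sub>R \<xi> p - \<eta> p (Y p) *\<^sub>R \<phi> p (X p)))"

definition D_homothetic ::
    "real \<Rightarrow> ('m \<Rightarrow> 'm tangent_vector \<Rightarrow> 'm tangent_vector) \<times> 'm vfield
       \<times> ('m \<Rightarrow> 'm tangent_vector \<Rightarrow> real) \<times> 'm metric_field
     \<Rightarrow> ('m \<Rightarrow> 'm tangent_vector \<Rightarrow> 'm tangent_vector) \<times> 'm vfield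
       \<times> ('m \<Rightarrow> 'm tangent_vector \<Rightarrow> real) \<times> 'm metric_field"
  where "D_homothetic a = (\<lambda>(\<phi>, \<xi>, \<eta>, g).
    (\<phi>,
     \<lambda>p. (1 / a) *\<^sub>R \<xi> p,
     \<lambda>p u. a * \<eta> p u,
     \<lambda>p u v. a * g p u v + a * (a - 1) * \<eta> p u * \<eta> p v))"

definition kulkarni_nomizu ::
    "('v \<Rightarrow> 'v \<Rightarrow> 'm \<Rightarrow> real) \<Rightarrow> ('v \<Rightarrow> 'v \<Rightarrow> 'm \<Rightarrow> real)
     \<Rightarrow> 'v \<Rightarrow> 'v \<Rightarrow> 'v \<Rightarrow> 'v \<Rightarrow> 'm \<Rightarrow> real"
  where "kulkarni_nomizu S T X Y Z W = (\<lambda>p.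
    S X W p * T Y Z p + S Y Z p * T X W p - S X Z p * T Y W p - S Y W p * T X Z p)"

definition almost_riemann_soliton ::
    "('m::{t2_space,second_countable_topology}, 'e::euclidean_space) chart set
     \<Rightarrow> 'm metric_field \<Rightarrow> ('m vfield \<Rightarrow> 'm vfield \<Rightarrow> 'm vfield)
     \<Rightarrow> 'm vfield \<Rightarrow> ('m \<Rightarrow> real) \<Rightarrow> bool"
  where "almost_riemann_soliton A h D V lam \<longleftrightarrow>
    riemannian_metric A h \<and> levi_civita_connection A h D \<and>
    vector_field A V \<and> (\<forall>p. V p \<noteq> 0) \<and> smooth_fun A lam \<and>
    (\<forall>X Y Z W. vector_field A X \<longrightarrow> vector_field A Y \<longrightarrow> vector_field A Z \<longrightarrow> vector_field A W \<longrightarrow>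
       (\<forall>p. kulkarni_nomizu (\<lambda>X Y p. 1 / 2 * lie_derivative_metric V h X Y p) (on_fields h) X Y Z W p
             + riemann_tensor h D X Y Z W p =
            lam p / 2 * kulkarni_nomizu (on_fields h) (on_fields h) X Y Z W p))"

end

theory Submission
  imports Defs "HOL-Computational_Algebra.Polynomial"
begin

text \<open>
  Write \<open>h = g - \<eta> \<otimes> \<eta>\<close> for the metric transverse to \<open>\<xi>\<close> and \<open>c = (a - 1) / a\<close>.  On a Kenmotsu manifold
  \<open>\<nabla>\<^sub>X \<xi> = X - \<eta>(X) \<xi>\<close> (lemma \<open>nabla_xi\<close>), so \<open>\<nabla>\<eta> = h\<close> is symmetric and \<open>\<eta>\<close> is closed.  This has
  three consequences.  The curvature satisfies \<open>R(X,Y)\<xi> = \<eta>(X) Y - \<eta>(Y) X\<close>, hence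
  \<open>Ric(\<xi>,\<xi>) = -2n\<close> (\<open>ricci_xi_xi\<close>).  The Levi-Civita connection of the deformed metric \<open>g'\<close> is
  \<open>\<nabla>\<^sub>X Y + c h(X,Y) \<xi>\<close> (\<open>deformed_connection\<close>), and its curvature is
  \<open>R(X,Y)Z + c (h(Y,Z) X - h(X,Z) Y)\<close> (\<open>deformed_curvature\<close>).  Finally \<open>T = 1/2 L\<^sub>V g'\<close> involves
  \<open>\<nabla>V\<close> and the differential of \<open>\<eta>(V)\<close> only (\<open>deformed_lie_derivative\<close>), and its \<open>g'\<close>-trace is
  the divergence of \<open>V\<close>, which is 0.

  Contracting the soliton equation therefore gives (\<open>soliton_ricci\<close>)
  \<open>Ric = 2n \<lambda> g' - (2n - 1) T - 2n c h\<close>.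
  At \<open>(\<xi>,\<xi>)\<close> this reads \<open>-2n = 2n \<lambda> a\<^sup>2 - (2n - 1) a\<^sup>2 \<xi>(\<eta>(V))\<close> and determines \<open>\<lambda>\<close>; inserting
  that value gives the formula for \<open>Ric\<close>, and one more trace gives the scalar curvature.

  The computations need some foundations.  Traces are taken over an orthonormal basis at a point
  that is extended to global vector fields, so such extensions have to exist; they are made by
  cutting off coordinate fields with a bump function (\<open>local_frame\<close>).  The tensor \<open>\<nabla>V\<close> is given
  on fields, and to contract it one needs that its value at \<open>p\<close> depends linearly on the value of
  the field at \<open>p\<close> (\<open>connection_tensorial\<close>).  All contractions are then instances of one
  identity of linear algebra in a single tangent space (\<open>orthonormal_contraction\<close>).
\<close>


section \<open>Calculus of smooth maps\<close>

lemma frechet_derivative_eqI: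
  "(f has_derivative f') (at x) \<Longrightarrow> frechet_derivative f (at x) v = f' v"
  by (metis frechet_derivative_at)

lemma differentiable_has_frechet:
  "f differentiable (at x) \<Longrightarrow> (f has_derivative frechet_derivative f (at x)) (at x)"
  using frechet_derivative_works by blast

lemma k_times_differentiable_cong:
  assumes "open S" "k_times_differentiable k S f" "\<And>x. x \<in> S \<Longrightarrow> f x = g x"
  shows "k_times_differentiable k S g"
  using assms(2,3)
proof (induction k arbitrary: f g)
  case 0
  then show ?case by (simp cong: continuous_on_cong)
next
  case (Suc k)
  have hd: "(g has_derivative frechet_derivative f (at x)) (at x)" if "x \<in> S" for x
    using has_derivative_transform_within_open[OF _ assms(1) that, of f _ UNIV g]
      Suc.prems that differentiable_has_frechet by force
  have eq: "frechet_derivative f (at x) v = frechet_derivative g (at x) v" if "x \<in> S" for x v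
    using frechet_derivative_eqI[OF hd[OF that]] by simp
  have "k_times_differentiable k S (\<lambda>x. frechet_derivative g (at x) v)" for v
    using Suc.IH[of "\<lambda>x. frechet_derivative f (at x) v"] Suc.prems(1) eq by simp
  then show ?case using hd by (auto simp: differentiable_def)
qed

lemma k_times_differentiable_subset:
  "k_times_differentiable k S f \<Longrightarrow> T \<subseteq> S \<Longrightarrow> k_times_differentiable k T f"
  by (induction k arbitrary: f) (auto intro: continuous_on_subset)

text \<open>Differentiability of any order is a local property; this glues a function that is smooth on
  two open sets.\<close>

lemma k_times_differentiable_local:
  assumes "\<And>x. x \<in> S \<Longrightarrow> \<exists>T. open T \<and> x \<in> T \<and> k_times_differentiable k T f"
  shows "k_times_differentiable k S f"
  using assms
proof (induction k arbitrary: f)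
  case 0
  have "continuous (at x) f" if "x \<in> S" for x
    using 0[OF that] by (auto simp: continuous_on_eq_continuous_at)
  then show ?case by (simp add: continuous_at_imp_continuous_on)
next
  case (Suc k)
  have "k_times_differentiable k S (\<lambda>x. frechet_derivative f (at x) v)" for v
    using Suc.prems by (intro Suc.IH) (metis k_times_differentiable.simps(2))
  moreover have "\<forall>x\<in>S. f differentiable (at x)"
    using Suc.prems by (metis k_times_differentiable.simps(2))
  ultimately show ?case by simp
qed

lemma k_times_differentiable_Suc_imp:
  "k_times_differentiable (Suc k) S f \<Longrightarrow> k_times_differentiable k S f"
proof (induction k arbitrary: f)
  case 0
  then show ?case
    by (auto intro!: continuous_at_imp_continuous_on differentiable_imp_continuous_within)
next
  case (Suc k)
  then show ?case by (metis k_times_differentiable.simps(2))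
qed

lemma k_times_differentiable_const [simp]: "k_times_differentiable k S (\<lambda>x. c)"
proof (induction k arbitrary: c)
  case (Suc k)
  have "frechet_derivative (\<lambda>x::'a. c) (at x) v = 0" for x v
    by (rule frechet_derivative_eqI) (rule has_derivative_const)
  then show ?case using Suc by simp
qed simp

lemma k_times_differentiable_linear_comp:
  assumes S: "open S" and L: "bounded_linear L" and f: "k_times_differentiable k S f"
  shows "k_times_differentiable k S (\<lambda>x. L (f x))"
  using f
proof (induction k arbitrary: f)
  case 0
  then show ?case using L by (simp add: bounded_linear.continuous_on)
next
  case (Suc k)
  have hd: "((\<lambda>x. L (f x)) has_derivative (\<lambda>v. L (frechet_derivative f (at x) v))) (at x)"
    if "x \<in> S" for x
    using bounded_linear.has_derivative[OF L] Suc.prems that differentiable_has_frechet by force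
  have "k_times_differentiable k S (\<lambda>x. frechet_derivative (\<lambda>x. L (f x)) (at x) v)" for v
  proof (rule k_times_differentiable_cong[OF S])
    show "k_times_differentiable k S (\<lambda>x. L (frechet_derivative f (at x) v))"
      using Suc.prems by (intro Suc.IH) simp
  qed (simp add: frechet_derivative_eqI[OF hd])
  then show ?case using hd by (auto simp: differentiable_def)
qed

lemma k_times_differentiable_bounded_linear:
  assumes S: "open S" and L: "bounded_linear L"
  shows "k_times_differentiable k S L"
proof -
  have hd: "(L has_derivative L) (at x)" for x
    using L by (rule bounded_linear_imp_has_derivative)
  show ?thesis
    by (cases k) (use hd frechet_derivative_eqI[OF hd] in
        \<open>auto simp: differentiable_def L linear_continuous_on\<close>)
qed

lemma k_times_differentiable_add:
  assumes S: "open S" and "k_times_differentiable k S f" "k_times_differentiable k S g"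
  shows "k_times_differentiable k S (\<lambda>x. f x + g x)"
  using assms(2,3)
proof (induction k arbitrary: f g)
  case 0
  then show ?case by (simp add: continuous_on_add)
next
  case (Suc k)
  have hd: "((\<lambda>x. f x + g x) has_derivative
      (\<lambda>v. frechet_derivative f (at x) v + frechet_derivative g (at x) v)) (at x)"
    if "x \<in> S" for x
    using Suc.prems that differentiable_has_frechet by (intro has_derivative_add) force+
  have "k_times_differentiable k S (\<lambda>x. frechet_derivative (\<lambda>x. f x + g x) (at x) v)" for v
  proof (rule k_times_differentiable_cong[OF S])
    show "k_times_differentiable k S
        (\<lambda>x. frechet_derivative f (at x) v + frechet_derivative g (at x) v)"
      using Suc.prems by (intro Suc.IH) auto
  qed (simp add: frechet_derivative_eqI[OF hd])
  then show ?case using hd by (auto simp: differentiable_def)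
qed

lemma k_times_differentiable_mult:
  fixes f g :: "'a::real_normed_vector \<Rightarrow> real"
  assumes S: "open S" and "k_times_differentiable k S f" "k_times_differentiable k S g"
  shows "k_times_differentiable k S (\<lambda>x. f x * g x)"
  using assms(2,3)
proof (induction k arbitrary: f g)
  case 0
  then show ?case by (simp add: continuous_on_mult)
next
  case (Suc k)
  have hd: "((\<lambda>x. f x * g x) has_derivative
      (\<lambda>v. f x * frechet_derivative g (at x) v + frechet_derivative f (at x) v * g x)) (at x)"
    if "x \<in> S" for x
    using Suc.prems that differentiable_has_frechet by (intro has_derivative_mult) force+
  note low = Suc.prems[THEN k_times_differentiable_Suc_imp]
  have "k_times_differentiable k S (\<lambda>x. frechet_derivative (\<lambda>x. f x * g x) (at x) v)" for v
  proof (rule k_times_differentiable_cong[OF S])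
    show "k_times_differentiable k S
        (\<lambda>x. f x * frechet_derivative g (at x) v + frechet_derivative f (at x) v * g x)"
      using Suc.prems low by (intro k_times_differentiable_add[OF S] Suc.IH) auto
  qed (simp add: frechet_derivative_eqI[OF hd])
  then show ?case using hd by (auto simp: differentiable_def)
qed

lemma k_times_differentiable_sum:
  assumes S: "open S" and I: "finite I" and "\<And>i. i \<in> I \<Longrightarrow> k_times_differentiable k S (f i)"
  shows "k_times_differentiable k S (\<lambda>x. \<Sum>i\<in>I. f i x)"
  using I assms(3)
  by (induction I rule: finite_induct) (auto intro: k_times_differentiable_add[OF S])

text \<open>The chain rule expresses a directional derivative of \<open>f \<circ> g\<close> through the partial
  derivatives of \<open>f\<close> composed with \<open>g\<close>, which makes the induction on the order work.\<close>

lemma k_times_differentiable_compose: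
  fixes f :: "'b::euclidean_space \<Rightarrow> real" and g :: "'a::real_normed_vector \<Rightarrow> 'b"
  assumes S: "open S" and "g ` S \<subseteq> T"
    and "k_times_differentiable k T f" "k_times_differentiable k S g"
  shows "k_times_differentiable k S (\<lambda>x. f (g x))"
  using assms(3,4)
proof (induction k arbitrary: f)
  case 0
  then show ?case using assms(2) by (auto intro: continuous_on_compose2)
next
  case (Suc k)
  have dg: "(g has_derivative frechet_derivative g (at x)) (at x)" if "x \<in> S" for x
    using Suc.prems(2) that by (intro differentiable_has_frechet) auto
  have df: "(f has_derivative frechet_derivative f (at (g x))) (at (g x))" if "x \<in> S" for x
    using Suc.prems(1) that assms(2) by (intro differentiable_has_frechet) auto
  have hd: "((\<lambda>x. f (g x)) has_derivative
      (\<lambda>v. frechet_derivative f (at (g x)) (frechet_derivative g (at x) v))) (at x)"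
    if "x \<in> S" for x
    using has_derivative_compose[OF dg[OF that] df[OF that]] .
  have expand: "frechet_derivative f (at (g x)) w =
      (\<Sum>i\<in>Basis. (w \<bullet> i) * frechet_derivative f (at (g x)) i)" if "x \<in> S" for x w
  proof -
    interpret linear "frechet_derivative f (at (g x))"
      using df[OF that] has_derivative_linear by blast
    have "frechet_derivative f (at (g x)) w =
        frechet_derivative f (at (g x)) (\<Sum>i\<in>Basis. (w \<bullet> i) *\<^sub>R i)"
      by (simp add: euclidean_representation)
    then show ?thesis by (simp add: sum scaleR)
  qed
  note low = Suc.prems[THEN k_times_differentiable_Suc_imp]
  have "k_times_differentiable k S (\<lambda>x. frechet_derivative (\<lambda>x. f (g x)) (at x) v)" for v
  proof (rule k_times_differentiable_cong[OF S])
    have "k_times_differentiable k S (\<lambda>x. frechet_derivative g (at x) v \<bullet> i)" for i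
      using Suc.prems by (intro k_times_differentiable_linear_comp[OF S bounded_linear_inner_left]) simp
    moreover have "k_times_differentiable k S (\<lambda>x. frechet_derivative f (at (g x)) i)" for i
      using Suc.prems low by (intro Suc.IH[of "\<lambda>y. frechet_derivative f (at y) i"]) auto
    ultimately have "k_times_differentiable k S
        (\<lambda>x. (frechet_derivative g (at x) v \<bullet> i) * frechet_derivative f (at (g x)) i)" for i
      using k_times_differentiable_mult[OF S] by blast
    then show "k_times_differentiable k S
        (\<lambda>x. \<Sum>i\<in>Basis. (frechet_derivative g (at x) v \<bullet> i) * frechet_derivative f (at (g x)) i)"
      using k_times_differentiable_sum[OF S finite_Basis,
          where f = "\<lambda>i x. (frechet_derivative g (at x) v \<bullet> i) * frechet_derivative f (at (g x)) i"]
      by blast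
    show "(\<Sum>i\<in>Basis. (frechet_derivative g (at x) v \<bullet> i) * frechet_derivative f (at (g x)) i) =
        frechet_derivative (\<lambda>x. f (g x)) (at x) v" if "x \<in> S" for x
      using expand[OF that, symmetric] frechet_derivative_eqI[OF hd[OF that], symmetric]
      by (rule trans)
  qed
  then show ?case using hd by (auto simp: differentiable_def)
qed

lemma C_infinity_on_cong:
  "open S \<Longrightarrow> C_infinity_on S f \<Longrightarrow> (\<And>x. x \<in> S \<Longrightarrow> f x = g x) \<Longrightarrow> C_infinity_on S g"
  unfolding C_infinity_on_def using k_times_differentiable_cong by blast

lemma C_infinity_on_subset: "C_infinity_on S f \<Longrightarrow> T \<subseteq> S \<Longrightarrow> C_infinity_on T f"
  unfolding C_infinity_on_def using k_times_differentiable_subset by blast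

lemma C_infinity_on_Un:
  assumes "open S" "open T" "C_infinity_on S f" "C_infinity_on T f"
  shows "C_infinity_on (S \<union> T) f"
  unfolding C_infinity_on_def
  by (intro allI k_times_differentiable_local) (use assms in \<open>auto simp: C_infinity_on_def\<close>)

lemma C_infinity_on_const [simp]: "C_infinity_on S (\<lambda>x. c)"
  by (simp add: C_infinity_on_def)

lemma C_infinity_on_add:
  "open S \<Longrightarrow> C_infinity_on S f \<Longrightarrow> C_infinity_on S g \<Longrightarrow> C_infinity_on S (\<lambda>x. f x + g x)"
  by (simp add: C_infinity_on_def k_times_differentiable_add)

lemma C_infinity_on_mult:
  fixes f g :: "'a::real_normed_vector \<Rightarrow> real"
  shows "open S \<Longrightarrow> C_infinity_on S f \<Longrightarrow> C_infinity_on S g \<Longrightarrow> C_infinity_on S (\<lambda>x. f x * g x)"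
  by (simp add: C_infinity_on_def k_times_differentiable_mult)

lemma C_infinity_on_compose:
  fixes f :: "'b::euclidean_space \<Rightarrow> real" and g :: "'a::real_normed_vector \<Rightarrow> 'b"
  shows "open S \<Longrightarrow> g ` S \<subseteq> T \<Longrightarrow> C_infinity_on T f \<Longrightarrow> C_infinity_on S g \<Longrightarrow>
    C_infinity_on S (\<lambda>x. f (g x))"
  by (simp add: C_infinity_on_def k_times_differentiable_compose)

lemma C_infinity_on_bounded_linear: "open S \<Longrightarrow> bounded_linear L \<Longrightarrow> C_infinity_on S L"
  by (simp add: C_infinity_on_def k_times_differentiable_bounded_linear)

lemma C_infinity_on_frechet_derivative:
  "C_infinity_on S f \<Longrightarrow> C_infinity_on S (\<lambda>x. frechet_derivative f (at x) v)"
  unfolding C_infinity_on_def by (metis k_times_differentiable.simps(2))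

lemma C_infinity_on_has_derivative:
  "C_infinity_on S f \<Longrightarrow> x \<in> S \<Longrightarrow> (f has_derivative frechet_derivative f (at x)) (at x)"
  unfolding C_infinity_on_def
  by (metis k_times_differentiable.simps(2) differentiable_has_frechet)


section \<open>A bump function\<close>

text \<open>The functions \<open>P(1/t) exp(-1/t)\<close>, continued by 0 to \<open>t \<le> 0\<close>, form a class that is closed
  under differentiation; hence all of them are smooth.\<close>

definition flat :: "real poly \<Rightarrow> real \<Rightarrow> real"
  where "flat P t = (if t > 0 then poly P (inverse t) * exp (- inverse t) else 0)"

lemma poly_div_exp_tendsto_0: "((\<lambda>x::real. poly P x * exp (- x)) \<longlongrightarrow> 0) at_top"
proof -
  have "((\<lambda>x::real. \<Sum>i\<le>degree P. coeff P i * (x ^ i / exp x)) \<longlongrightarrow>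
      (\<Sum>i\<le>degree P. coeff P i * 0)) at_top"
    by (intro tendsto_sum tendsto_mult_left tendsto_power_div_exp_0)
  moreover have "(\<lambda>x. \<Sum>i\<le>degree P. coeff P i * (x ^ i / exp x)) = (\<lambda>x. poly P x * exp (- x))"
    by (simp add: poly_altdef sum_distrib_right exp_minus divide_inverse mult.assoc)
  ultimately show ?thesis by simp
qed

text \<open>For \<open>t > 0\<close> the factor \<open>X\<^sup>2\<close> comes from the derivative \<open>- 1/t\<^sup>2\<close> of \<open>1/t\<close>.  At 0 the difference
  quotient is a function of the same kind, with \<open>X P\<close> for \<open>P\<close>, and tends to 0 because \<open>exp\<close>
  beats every polynomial.\<close>

lemma flat_has_derivative:
  "(flat P has_real_derivative flat ((P - pderiv P) * [:0, 0, 1:]) t) (at t)"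
proof (cases t "0::real" rule: linorder_cases)
  case less
  have "((\<lambda>_. 0) has_real_derivative 0) (at t)" by simp
  then have "(flat P has_real_derivative 0) (at t)"
    by (rule has_field_derivative_transform_within_open[of _ _ _ "{..<0}"])
      (use less in \<open>auto simp: flat_def\<close>)
  then show ?thesis using less by (simp add: flat_def)
next
  case greater
  have "((\<lambda>t. poly P (inverse t) * exp (- inverse t)) has_real_derivative
      flat ((P - pderiv P) * [:0, 0, 1:]) t) (at t)"
    using greater
    by (auto intro!: derivative_eq_intros simp: flat_def algebra_simps power2_eq_square)
  then show ?thesis
    by (rule has_field_derivative_transform_within_open[of _ _ _ "{0<..}"])
      (use greater in \<open>auto simp: flat_def\<close>)
next
  case equal
  have "((\<lambda>h. poly (pCons 0 P) (inverse h) * exp (- inverse h)) \<longlongrightarrow> 0) (at_right (0::real))"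
    using filterlim_compose[OF poly_div_exp_tendsto_0 filterlim_inverse_at_top_right] .
  then have "((\<lambda>h. (flat P h - flat P 0) / h) \<longlongrightarrow> 0) (at_right (0::real))"
    by (rule Lim_transform_eventually)
      (auto simp: eventually_at_right_field flat_def divide_inverse mult_ac intro!: exI[of _ 1])
  moreover have "((\<lambda>h. (flat P h - flat P 0) / h) \<longlongrightarrow> 0) (at_left (0::real))"
    by (rule Lim_transform_eventually[OF tendsto_const])
      (auto simp: eventually_at_left_field flat_def intro!: exI[of _ "-1"])
  ultimately have "((\<lambda>h. (flat P h - flat P 0) / h) \<longlongrightarrow> 0) (at 0)"
    by (simp add: filterlim_split_at)
  then show ?thesis using equal by (simp add: DERIV_def flat_def)
qed

lemma C_infinity_on_flat: "C_infinity_on UNIV (flat P)"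
proof -
  have "k_times_differentiable k UNIV (flat P)" for k
  proof (induction k arbitrary: P)
    case 0
    show ?case
      using DERIV_isCont[OF flat_has_derivative] by (simp add: continuous_on_eq_continuous_at)
  next
    case (Suc k)
    have hd: "(flat P has_derivative (\<lambda>v. flat ((P - pderiv P) * [:0, 0, 1:]) x * v)) (at x)" for x
      using flat_has_derivative by (simp add: has_field_derivative_def)
    have "k_times_differentiable k UNIV (\<lambda>x. frechet_derivative (flat P) (at x) v)" for v
      by (simp only: frechet_derivative_eqI[OF hd])
        (intro k_times_differentiable_mult k_times_differentiable_const Suc.IH open_UNIV)
    then show ?case using hd by (auto simp: differentiable_def)
  qed
  then show ?thesis by (simp add: C_infinity_on_def)
qed

lemma bump_exists:
  fixes x0 :: "'e::euclidean_space"
  assumes "r > 0"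
  shows "\<exists>B :: 'e \<Rightarrow> real. C_infinity_on UNIV B \<and> B x0 = 1 \<and> (\<forall>x. x \<notin> cball x0 r \<longrightarrow> B x = 0)"
proof -
  \<comment> \<open>This is \<open>r\<^sup>2 - |x - x0|\<^sup>2\<close>, positive exactly inside the ball; coordinates show its smoothness.\<close>
  define N where "N x = r\<^sup>2 + (-1) * (\<Sum>i\<in>Basis. ((x + - x0) \<bullet> i) * ((x + - x0) \<bullet> i))" for x :: 'e
  have N: "N x = r\<^sup>2 - (dist x0 x)\<^sup>2" for x
    using euclidean_inner[of "x - x0" "x - x0"]
    by (simp add: N_def dist_norm power2_norm_eq_inner norm_minus_commute[of x0])
  have lin: "k_times_differentiable k UNIV (\<lambda>x. (x + - x0) \<bullet> i)" for k and i :: 'e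
    by (rule k_times_differentiable_linear_comp[OF open_UNIV bounded_linear_inner_left])
      (intro k_times_differentiable_add k_times_differentiable_const
        k_times_differentiable_bounded_linear bounded_linear_ident open_UNIV)
  have "C_infinity_on UNIV N"
    unfolding C_infinity_on_def N_def
    by (intro allI k_times_differentiable_add k_times_differentiable_const
        k_times_differentiable_mult k_times_differentiable_sum lin open_UNIV finite_Basis)
  then have "C_infinity_on UNIV (\<lambda>x. flat 1 (N x) * inverse (flat 1 (r\<^sup>2)))"
    by (intro C_infinity_on_mult C_infinity_on_compose[OF _ _ C_infinity_on_flat]) auto
  moreover have "flat 1 (r\<^sup>2) \<noteq> 0" using assms by (simp add: flat_def)
  moreover have "flat 1 (N x) = 0" if "x \<notin> cball x0 r" for x
  proof -
    have "r\<^sup>2 \<le> (dist x0 x)\<^sup>2" using that assms by (intro power_mono) auto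
    then show ?thesis by (simp add: flat_def N)
  qed
  ultimately show ?thesis
    by (intro exI[of _ "\<lambda>x. flat 1 (N x) * inverse (flat 1 (r\<^sup>2))"]) (auto simp: N)
qed

section \<open>Tangent vectors and vector fields\<close>

definition coord_vector ::
    "('m::{t2_space,second_countable_topology}, 'e::euclidean_space) chart set
     \<Rightarrow> 'm set \<Rightarrow> ('m \<Rightarrow> 'e) \<Rightarrow> 'm \<Rightarrow> 'e \<Rightarrow> 'm tangent_vector"
  where "coord_vector A U c p u =
    (\<lambda>f. if smooth_fun A f then frechet_derivative (f \<circ> inv_into U c) (at (c p)) u else 0)"

lemma tangent_space_eq:
  "tangent_space A p = {v. \<exists>(U, c)\<in>A. p \<in> U \<and> v \<in> range (coord_vector A U c p)}"
  unfolding tangent_space_def coord_vector_def by (auto simp: fun_eq_iff image_iff)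

locale smooth_manifold =
  fixes A :: "('m::{t2_space,second_countable_topology}, 'e::euclidean_space) chart set"
  assumes atlas: "smooth_atlas A"
begin

lemma chart_exists: obtains U c where "(U, c) \<in> A" "q \<in> U"
proof -
  have "q \<in> (\<Union>(U, c)\<in>A. U)" using atlas by (simp add: smooth_atlas_def)
  then show ?thesis using that by auto
qed

lemma chart_homeomorphism: "(U, c) \<in> A \<Longrightarrow> homeomorphism U (c ` U) c (inv_into U c)"
  using atlas unfolding smooth_atlas_def by blast

lemma chart_open: "(U, c) \<in> A \<Longrightarrow> open U" "(U, c) \<in> A \<Longrightarrow> open (c ` U)"
  using atlas unfolding smooth_atlas_def by blast+

lemma chart_inv: "(U, c) \<in> A \<Longrightarrow> q \<in> U \<Longrightarrow> inv_into U c (c q) = q"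
  using chart_homeomorphism homeomorphism_apply1 by blast

lemma chart_image_open: "(U, c) \<in> A \<Longrightarrow> open W \<Longrightarrow> W \<subseteq> U \<Longrightarrow> open (c ` W)"
  using homeomorphism_imp_open_map[OF chart_homeomorphism, of U c W]
  by (simp add: openin_open_eq[OF chart_open(1)] openin_open_eq[OF chart_open(2)])

lemma transition:
  "(U, c) \<in> A \<Longrightarrow> (U', c') \<in> A \<Longrightarrow> C_infinity_on (c ` (U \<inter> U')) (c' \<circ> inv_into U c)"
  using atlas unfolding smooth_atlas_def by blast

lemma transition_open: "(U, c) \<in> A \<Longrightarrow> (U', c') \<in> A \<Longrightarrow> open (c ` (U \<inter> U'))"
  by (simp add: chart_image_open chart_open open_Int)

lemma smooth_funD: "smooth_fun A f \<Longrightarrow> (U, c) \<in> A \<Longrightarrow> C_infinity_on (c ` U) (f \<circ> inv_into U c)"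
  unfolding smooth_fun_def by blast

lemma smooth_funI:
  "(\<And>U c. (U, c) \<in> A \<Longrightarrow> C_infinity_on (c ` U) (f \<circ> inv_into U c)) \<Longrightarrow> smooth_fun A f"
  unfolding smooth_fun_def by blast

lemma chart_change:
  fixes F :: "'m \<Rightarrow> real"
  assumes c: "(U, c) \<in> A" and c': "(U', c') \<in> A"
    and F: "C_infinity_on (c ` U) (F \<circ> inv_into U c)"
  shows "C_infinity_on (c' ` (U' \<inter> U)) (F \<circ> inv_into U' c')"
proof (rule C_infinity_on_cong[OF transition_open[OF c' c]])
  have "(c \<circ> inv_into U' c') ` c' ` (U' \<inter> U) \<subseteq> c ` U"
    by (auto simp: chart_inv[OF c'])
  from C_infinity_on_compose[OF transition_open[OF c' c] this F transition[OF c' c]]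
  show "C_infinity_on (c' ` (U' \<inter> U))
      (\<lambda>x. (F \<circ> inv_into U c) ((c \<circ> inv_into U' c') x))" .
qed (auto simp: chart_inv[OF c] chart_inv[OF c'])

lemma smooth_fun_has_derivative:
  assumes "smooth_fun A f" "(U, c) \<in> A" "p \<in> U"
  shows "((f \<circ> inv_into U c) has_derivative (\<lambda>u. coord_vector A U c p u f)) (at (c p))"
  using C_infinity_on_has_derivative[OF smooth_funD[OF assms(1,2)], of "c p"] assms
  by (simp add: coord_vector_def)

lemma coord_vector_eqI:
  assumes "smooth_fun A f" "((f \<circ> inv_into U c) has_derivative f') (at (c p))"
  shows "coord_vector A U c p u f = f' u"
  using assms by (simp add: coord_vector_def frechet_derivative_eqI)

text \<open>The chain rule for the transition map between the charts.\<close>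

lemma coord_vector_change:
  assumes c: "(U, c) \<in> A" and c': "(U', c') \<in> A" and p: "p \<in> U" "p \<in> U'"
  shows "coord_vector A U c p u =
    coord_vector A U' c' p (frechet_derivative (c' \<circ> inv_into U c) (at (c p)) u)"
proof (rule ext)
  fix f
  let ?t = "c' \<circ> inv_into U c"
  show "coord_vector A U c p u f = coord_vector A U' c' p (frechet_derivative ?t (at (c p)) u) f"
  proof (cases "smooth_fun A f")
    case True
    have mem: "c p \<in> c ` (U \<inter> U')" using p by blast
    have t: "(?t has_derivative frechet_derivative ?t (at (c p))) (at (c p))"
      using C_infinity_on_has_derivative[OF transition[OF c c'] mem] .
    have "((f \<circ> inv_into U' c') has_derivative (\<lambda>u. coord_vector A U' c' p u f)) (at (?t (c p)))"
      using smooth_fun_has_derivative[OF True c' p(2)] chart_inv[OF c p(1)] by simp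
    from has_derivative_compose[OF t this]
    have "((f \<circ> inv_into U c) has_derivative
        (\<lambda>u. coord_vector A U' c' p (frechet_derivative ?t (at (c p)) u) f)) (at (c p))"
      by (rule has_derivative_transform_within_open[OF _ transition_open[OF c c'] mem])
        (auto simp: chart_inv[OF c] chart_inv[OF c'])
    then show ?thesis by (rule coord_vector_eqI[OF True])
  qed (simp add: coord_vector_def)
qed

text \<open>The definition of the tangent space lets the chart vary with the vector; a single chart
  already yields all tangent vectors, which makes the tangent space a vector space.\<close>

lemma tangent_space_chart:
  assumes "(U, c) \<in> A" "p \<in> U"
  shows "tangent_space A p = range (coord_vector A U c p)"
  unfolding tangent_space_eq using assms coord_vector_change by blast

lemma coord_vector_linear:
  assumes "(U, c) \<in> A" "p \<in> U"
  shows "linear (coord_vector A U c p)"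
proof -
  have *: "linear (\<lambda>u. coord_vector A U c p u f)" for f
  proof (cases "smooth_fun A f")
    case True
    then show ?thesis using smooth_fun_has_derivative[OF True assms] has_derivative_linear by blast
  qed (simp add: coord_vector_def linear_zero)
  show ?thesis
    by (rule linearI) (auto simp: fun_eq_iff scaleR_fun_def linear_add[OF *] linear_scale[OF *])
qed

lemma tangent_space_subspace: "subspace (tangent_space A p)"
proof -
  obtain U c where "(U, c) \<in> A" "p \<in> U" by (rule chart_exists)
  then show ?thesis
    using linear_subspace_image[OF coord_vector_linear subspace_UNIV] by (simp add: tangent_space_chart)
qed

lemmas tangent_add = subspace_add[OF tangent_space_subspace]
  and tangent_diff = subspace_diff[OF tangent_space_subspace]
  and tangent_scale = subspace_scale[OF tangent_space_subspace]
  and tangent_sum = subspace_sum[OF tangent_space_subspace]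
  and tangent_0 = subspace_0[OF tangent_space_subspace]

lemma tangent_not_smooth: "v \<in> tangent_space A p \<Longrightarrow> \<not> smooth_fun A f \<Longrightarrow> v f = 0"
  unfolding tangent_space_def by auto

lemma smooth_fun_const [simp]: "smooth_fun A (\<lambda>q. r)"
  by (rule smooth_funI) (simp add: comp_def)

lemma smooth_fun_add: "smooth_fun A f \<Longrightarrow> smooth_fun A h \<Longrightarrow> smooth_fun A (\<lambda>q. f q + h q)"
  using C_infinity_on_add[OF chart_open(2) smooth_funD smooth_funD] by (intro smooth_funI) (simp add: comp_def)

lemma smooth_fun_mult: "smooth_fun A f \<Longrightarrow> smooth_fun A h \<Longrightarrow> smooth_fun A (\<lambda>q. f q * h q)"
  using C_infinity_on_mult[OF chart_open(2) smooth_funD smooth_funD] by (intro smooth_funI) (simp add: comp_def)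

lemma smooth_fun_diff:
  assumes "smooth_fun A f" "smooth_fun A h" shows "smooth_fun A (\<lambda>q. f q - h q)"
  using smooth_fun_add[OF assms(1) smooth_fun_mult[OF smooth_fun_const[of "-1"] assms(2)]] by simp

context
  fixes v p
  assumes v: "v \<in> tangent_space A p"
begin

lemma tangent_const: "v (\<lambda>q. r) = 0"
proof -
  obtain U c u where c: "(U, c) \<in> A" "p \<in> U" and u: "v = coord_vector A U c p u"
    using v unfolding tangent_space_eq by blast
  show ?thesis unfolding u
    by (rule coord_vector_eqI[of _ U c "\<lambda>_. 0"]) (simp_all add: comp_def)
qed

lemma tangent_fun_add:
  assumes f: "smooth_fun A f" and h: "smooth_fun A h"
  shows "v (\<lambda>q. f q + h q) = v f + v h"
proof -
  obtain U c u where c: "(U, c) \<in> A" "p \<in> U" and u: "v = coord_vector A U c p u"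
    using v unfolding tangent_space_eq by blast
  have "(((\<lambda>q. f q + h q) \<circ> inv_into U c) has_derivative
      (\<lambda>u. coord_vector A U c p u f + coord_vector A U c p u h)) (at (c p))"
    using has_derivative_add[OF smooth_fun_has_derivative[OF f c] smooth_fun_has_derivative[OF h c]]
    by (simp add: comp_def)
  then show ?thesis unfolding u by (rule coord_vector_eqI[OF smooth_fun_add[OF f h]])
qed

lemma tangent_fun_mult:
  assumes f: "smooth_fun A f" and h: "smooth_fun A h"
  shows "v (\<lambda>q. f q * h q) = f p * v h + v f * h p"
proof -
  obtain U c u where c: "(U, c) \<in> A" "p \<in> U" and u: "v = coord_vector A U c p u"
    using v unfolding tangent_space_eq by blast
  have "(((\<lambda>q. f q * h q) \<circ> inv_into U c) has_derivative
      (\<lambda>u. f p * coord_vector A U c p u h + coord_vector A U c p u f * h p)) (at (c p))"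
    using has_derivative_mult[OF smooth_fun_has_derivative[OF f c] smooth_fun_has_derivative[OF h c]]
    by (simp add: comp_def chart_inv[OF c])
  then show ?thesis unfolding u by (rule coord_vector_eqI[OF smooth_fun_mult[OF f h]])
qed

lemma tangent_fun_cmult:
  assumes "smooth_fun A f" shows "v (\<lambda>q. r * f q) = r * v f"
  using tangent_fun_mult[OF smooth_fun_const assms] tangent_const by simp

lemma tangent_fun_diff:
  assumes "smooth_fun A f" "smooth_fun A h" shows "v (\<lambda>q. f q - h q) = v f - v h"
  using tangent_fun_add[OF assms(1) smooth_fun_mult[OF smooth_fun_const[of "-1"] assms(2)]]
    tangent_fun_cmult[OF assms(2), of "-1"] by simp

end

lemma vector_fieldD: "vector_field A X \<Longrightarrow> X p \<in> tangent_space A p"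
  unfolding vector_field_def by blast

lemma vector_field_smooth:
  assumes "vector_field A X" shows "smooth_fun A (\<lambda>q. X q f)"
proof (cases "smooth_fun A f")
  case False
  then have "X q f = 0" for q using assms tangent_not_smooth vector_fieldD by blast
  then show ?thesis by simp
qed (use assms in \<open>auto simp: vector_field_def\<close>)

lemma vector_field_add:
  assumes "vector_field A X" "vector_field A Y" shows "vector_field A (\<lambda>q. X q + Y q)"
  using assms smooth_fun_add tangent_add unfolding vector_field_def by (simp add: plus_fun_def)

lemma vector_field_scale:
  assumes "smooth_fun A f" "vector_field A X" shows "vector_field A (\<lambda>q. f q *\<^sub>R X q)"
  using assms smooth_fun_mult tangent_scale unfolding vector_field_def by (simp add: scaleR_fun_def)

lemma vector_field_diff:
  assumes "vector_field A X" "vector_field A Y" shows "vector_field A (\<lambda>q. X q - Y q)"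
  using assms smooth_fun_diff tangent_diff unfolding vector_field_def by (simp add: fun_diff_def)

lemma vector_field_zero: "vector_field A (\<lambda>q. 0)"
  unfolding vector_field_def using tangent_0 by (simp add: zero_fun_def)


section \<open>Extension of tangent vectors and locality\<close>

text \<open>The compact set \<open>K\<close> is closed because the manifold is Hausdorff.  So every other chart domain is
  covered by two open sets: its intersection with \<open>U\<close>, where \<open>F\<close> is smooth, and the complement of
  \<open>K\<close>, where \<open>F\<close> vanishes.\<close>

lemma smooth_fun_supported_in_chart:
  fixes F :: "'m \<Rightarrow> real"
  assumes c: "(U, c) \<in> A" and K: "compact K" "K \<subseteq> U" "\<And>q. q \<notin> K \<Longrightarrow> F q = 0"
    and F: "C_infinity_on (c ` U) (F \<circ> inv_into U c)"
  shows "smooth_fun A F"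
proof (rule smooth_funI)
  fix U' c' assume c': "(U', c') \<in> A"
  have op: "open (U' - K)" using chart_open(1)[OF c'] K(1) by (simp add: compact_imp_closed open_Diff)
  have "C_infinity_on (c' ` (U' - K)) (F \<circ> inv_into U' c')"
    by (rule C_infinity_on_cong[OF chart_image_open[OF c' op] C_infinity_on_const[of _ 0]])
      (auto simp: chart_inv[OF c'] K(3))
  then have "C_infinity_on (c' ` (U' \<inter> U) \<union> c' ` (U' - K)) (F \<circ> inv_into U' c')"
    using C_infinity_on_Un chart_change[OF c c' F] transition_open[OF c' c]
      chart_image_open[OF c' op] by blast
  moreover have "c' ` (U' \<inter> U) \<union> c' ` (U' - K) = c' ` U'" using K(2) by blast
  ultimately show "C_infinity_on (c' ` U') (F \<circ> inv_into U' c')" by simp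
qed

text \<open>A bump function in coordinates turns every smooth function on the chart domain into a global
  one with the same value at \<open>p\<close>.\<close>

lemma chart_cutoff:
  assumes c: "(U, c) \<in> A" and p: "p \<in> U"
  obtains B :: "'e \<Rightarrow> real" where "B (c p) = 1" "C_infinity_on (c ` U) B"
    "\<And>G. C_infinity_on (c ` U) G \<Longrightarrow> smooth_fun A (\<lambda>q. if q \<in> U then B (c q) * G (c q) else 0)"
proof -
  obtain r where r: "r > 0" "cball (c p) r \<subseteq> c ` U"
    using chart_open(2)[OF c] p open_contains_cball by blast
  obtain B :: "'e \<Rightarrow> real" where
    "C_infinity_on UNIV B \<and> B (c p) = 1 \<and> (\<forall>x. x \<notin> cball (c p) r \<longrightarrow> B x = 0)"
    using bump_exists[OF r(1), of "c p"] by (rule exE)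
  then have B: "C_infinity_on UNIV B" "B (c p) = 1" "\<And>x. x \<notin> cball (c p) r \<Longrightarrow> B x = 0"
    by simp_all
  have BU: "C_infinity_on (c ` U) B" using B(1) C_infinity_on_subset by blast
  let ?K = "inv_into U c ` cball (c p) r"
  have K: "compact ?K" "?K \<subseteq> U"
    using compact_continuous_image[OF continuous_on_subset[OF
          homeomorphism_cont2[OF chart_homeomorphism[OF c]] r(2)]] r(2)
    by (auto simp: chart_inv[OF c])
  have "smooth_fun A (\<lambda>q. if q \<in> U then B (c q) * G (c q) else 0)" if G: "C_infinity_on (c ` U) G" for G
  proof (rule smooth_fun_supported_in_chart[OF c K])
    show "(if q \<in> U then B (c q) * G (c q) else 0) = 0" if "q \<notin> ?K" for q
    proof (cases "q \<in> U")
      case True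
      then have "c q \<notin> cball (c p) r" using that chart_inv[OF c True] by force
      then show ?thesis using B(3) by simp
    qed simp
    show "C_infinity_on (c ` U)
        ((\<lambda>q. if q \<in> U then B (c q) * G (c q) else 0) \<circ> inv_into U c)"
      by (rule C_infinity_on_cong[OF chart_open(2)[OF c] C_infinity_on_mult[OF chart_open(2)[OF c] BU G]])
        (auto simp: chart_inv[OF c])
  qed
  then show ?thesis using that B(2) BU by blast
qed

text \<open>In a chart around \<open>p\<close> write \<open>\<theta>\<close> for a cutoff function and \<open>x\<^sub>i\<close> for the coordinates.  The
  functions \<open>\<theta> x\<^sub>i\<close> and the fields \<open>\<theta> \<partial>\<^sub>i\<close> are global, and the Leibniz rule gives
  \<open>\<theta> X(\<theta> x\<^sub>i) - \<theta> x\<^sub>i X(\<theta>) = \<theta>\<^sup>2 X(x\<^sub>i)\<close>.  So \<open>\<theta>\<^sup>3 X\<close> is a combination of the \<open>\<theta> \<partial>\<^sub>i\<close> whose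
  coefficients are global smooth functions and vanish wherever \<open>X\<close> does.  The last two clauses say
  that the \<open>\<theta> \<partial>\<^sub>i\<close> form a basis of the tangent space at \<open>p\<close>.\<close>

lemma local_frame:
  obtains b :: "'m \<Rightarrow> real" and Z :: "'e \<Rightarrow> 'm vfield" and F :: "'e \<Rightarrow> 'm vfield \<Rightarrow> 'm \<Rightarrow> real" where
    "smooth_fun A b" "b p = 1" "\<And>i. vector_field A (Z i)"
    "\<And>i X. vector_field A X \<Longrightarrow> smooth_fun A (F i X)"
    "\<And>i X. X p = 0 \<Longrightarrow> F i X p = 0"
    "\<And>X. vector_field A X \<Longrightarrow> (\<lambda>q. b q *\<^sub>R X q) = (\<lambda>q. \<Sum>i\<in>Basis. F i X q *\<^sub>R Z i q)"
    "\<And>v. v \<in> tangent_space A p \<Longrightarrow> \<exists>u. v = (\<Sum>i\<in>Basis. (u \<bullet> i) *\<^sub>R Z i p)"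
    "\<And>u. (\<Sum>i\<in>Basis. (u \<bullet> i) *\<^sub>R Z i p) = 0 \<Longrightarrow> u = 0"
proof -
  obtain U c where c: "(U, c) \<in> A" and p: "p \<in> U" by (rule chart_exists)
  note opU = chart_open(2)[OF c]
  obtain B where B1: "B (c p) = 1" and BU: "C_infinity_on (c ` U) B" and
    cut: "\<And>G. C_infinity_on (c ` U) G \<Longrightarrow> smooth_fun A (\<lambda>q. if q \<in> U then B (c q) * G (c q) else 0)"
    using chart_cutoff[OF c p] by blast
  define \<theta> where "\<theta> q = (if q \<in> U then B (c q) else 0)" for q
  define \<psi> where "\<psi> i q = (if q \<in> U then B (c q) * (c q \<bullet> i) else 0)" for i q
  define Z where "Z i q = (if q \<in> U then B (c q) *\<^sub>R coord_vector A U c q i else 0)" for i q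
  define F where "F i X q = \<theta> q * X q (\<psi> i) + (-1) * (\<psi> i q * X q \<theta>)"
    for i and X :: "'m vfield" and q
  have \<theta>: "smooth_fun A \<theta>" unfolding \<theta>_def using cut[of "\<lambda>_. 1"] by (simp cong: if_cong)
  have lin: "bounded_linear (\<lambda>x. x \<bullet> i)" for i :: 'e by (rule bounded_linear_inner_left)
  have \<psi>: "smooth_fun A (\<psi> i)" for i
    unfolding \<psi>_def using cut[OF C_infinity_on_bounded_linear[OF opU lin]] .
  have Z: "vector_field A (Z i)" for i
    unfolding vector_field_def
  proof (intro conjI allI impI)
    have "coord_vector A U c q i \<in> tangent_space A q" if "q \<in> U" for q
      using tangent_space_chart[OF c that] by blast
    then show "Z i q \<in> tangent_space A q" for q by (simp add: Z_def tangent_scale tangent_0)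
    fix f assume f: "smooth_fun A f"
    have "smooth_fun A (\<lambda>q. if q \<in> U then B (c q) * coord_vector A U c q i f else 0)"
      using cut[OF C_infinity_on_frechet_derivative[OF smooth_funD[OF f c]], of i] f
      by (simp add: coord_vector_def cong: if_cong)
    moreover have "(\<lambda>q. if q \<in> U then B (c q) * coord_vector A U c q i f else 0) = (\<lambda>q. Z i q f)"
      by (auto simp: Z_def scaleR_fun_def)
    ultimately show "smooth_fun A (\<lambda>q. Z i q f)" by simp
  qed
  have \<theta>_smooth: "C_infinity_on (c ` U) (\<theta> \<circ> inv_into U c)" using smooth_funD[OF \<theta> c] .
  have dB: "(B has_derivative frechet_derivative B (at (c q))) (at (c q))" if "q \<in> U" for q
    using C_infinity_on_has_derivative[OF BU] that by blast
  have X\<theta>: "coord_vector A U c q w \<theta> = frechet_derivative B (at (c q)) w" if q: "q \<in> U" for q w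
    by (rule coord_vector_eqI[OF \<theta>], rule has_derivative_transform_within_open[OF dB[OF q] opU])
      (use q in \<open>auto simp: \<theta>_def chart_inv[OF c]\<close>)
  have X\<psi>: "coord_vector A U c q w (\<psi> i) =
      B (c q) * (w \<bullet> i) + frechet_derivative B (at (c q)) w * (c q \<bullet> i)" if q: "q \<in> U" for q w i
    by (rule coord_vector_eqI[OF \<psi>], rule has_derivative_transform_within_open[OF
          has_derivative_mult[OF dB[OF q] bounded_linear_imp_has_derivative[OF lin]] opU])
      (use q in \<open>auto simp: \<psi>_def chart_inv[OF c]\<close>)
  have F_coord: "F i X q = (B (c q))\<^sup>2 * (w \<bullet> i)"
    if "q \<in> U" "X q = coord_vector A U c q w" for X q w i
    using that by (simp add: F_def X\<theta> X\<psi>) (simp add: \<theta>_def \<psi>_def algebra_simps power2_eq_square)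
  have expand: "coord_vector A U c q w = (\<Sum>i\<in>Basis. (w \<bullet> i) *\<^sub>R coord_vector A U c q i)"
    if "q \<in> U" for q w
  proof -
    interpret linear "coord_vector A U c q" using coord_vector_linear[OF c that] .
    have "coord_vector A U c q w = coord_vector A U c q (\<Sum>i\<in>Basis. (w \<bullet> i) *\<^sub>R i)"
      by (simp add: euclidean_representation)
    then show ?thesis by (simp only: sum scale)
  qed
  have comb: "\<theta> q ^ 3 *\<^sub>R X q = (\<Sum>i\<in>Basis. F i X q *\<^sub>R Z i q)" if X: "vector_field A X" for X q
  proof (cases "q \<in> U")
    case True
    obtain w where w: "X q = coord_vector A U c q w"
      using vector_fieldD[OF X] tangent_space_chart[OF c True] by blast
    have "\<theta> q ^ 3 *\<^sub>R X q = B (c q) ^ 3 *\<^sub>R (\<Sum>i\<in>Basis. (w \<bullet> i) *\<^sub>R coord_vector A U c q i)"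
      using True w expand[OF True, symmetric, of w] by (simp add: \<theta>_def)
    also have "\<dots> = (\<Sum>i\<in>Basis. B (c q) ^ 3 *\<^sub>R (w \<bullet> i) *\<^sub>R coord_vector A U c q i)"
      by (rule scaleR_sum_right)
    finally show ?thesis
      using True F_coord[where X = X, OF True w] by (simp add: Z_def power2_eq_square power3_eq_cube mult_ac)
  qed (simp add: Z_def \<theta>_def)
  have Zp: "(\<Sum>i\<in>Basis. (u \<bullet> i) *\<^sub>R Z i p) = coord_vector A U c p u" for u
    using p B1 expand[OF p, symmetric, of u] by (simp add: Z_def)
  show ?thesis
  proof (rule that[of "\<lambda>q. \<theta> q ^ 3" Z F])
    show "smooth_fun A (\<lambda>q. \<theta> q ^ 3)"
      using smooth_fun_mult[OF \<theta> smooth_fun_mult[OF \<theta> \<theta>]] by (simp add: power3_eq_cube mult.assoc)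
    show "smooth_fun A (F i X)" if "vector_field A X" for i X
      unfolding F_def
      using smooth_fun_add[OF smooth_fun_mult[OF \<theta> vector_field_smooth[OF that]] smooth_fun_mult[OF
            smooth_fun_const[of "-1"] smooth_fun_mult[OF \<psi> vector_field_smooth[OF that]]]] .
    show "u = 0" if "(\<Sum>i\<in>Basis. (u \<bullet> i) *\<^sub>R Z i p) = 0" for u
    proof (rule euclidean_eqI)
      fix i :: 'e assume "i \<in> Basis"
      have "coord_vector A U c p u = 0" using that Zp by simp
      then have "F i (\<lambda>q. coord_vector A U c p u) p = 0" by (simp add: F_def)
      then show "u \<bullet> i = 0 \<bullet> i"
        using F_coord[OF p, of "\<lambda>q. coord_vector A U c p u" u i] B1 by simp
    qed
    show "\<exists>u. v = (\<Sum>i\<in>Basis. (u \<bullet> i) *\<^sub>R Z i p)" if "v \<in> tangent_space A p" for v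
      using that tangent_space_chart[OF c p] by (auto simp: Zp)
    show "(\<lambda>q. \<theta> q ^ 3 *\<^sub>R X q) = (\<lambda>q. \<Sum>i\<in>Basis. F i X q *\<^sub>R Z i q)"
      if "vector_field A X" for X
      using comb[OF that] by (rule ext)
    show "F i X p = 0" if "X p = 0" for i X using that by (simp add: F_def)
  qed (use p B1 Z in \<open>simp_all add: \<theta>_def\<close>)
qed

lemma vector_field_sum:
  assumes "\<And>i. i \<in> I \<Longrightarrow> vector_field A (X i)" shows "vector_field A (\<lambda>q. \<Sum>i\<in>I. X i q)"
  using assms
  by (induction I rule: infinite_finite_induct) (auto simp: vector_field_zero vector_field_add)

lemma tangent_extends:
  assumes "v \<in> tangent_space A p" obtains X where "vector_field A X" "X p = v"
proof -
  obtain Z :: "'e \<Rightarrow> 'm vfield" where Z: "\<And>i. vector_field A (Z i)"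
    "\<And>v. v \<in> tangent_space A p \<Longrightarrow> \<exists>u. v = (\<Sum>i\<in>Basis. (u \<bullet> i) *\<^sub>R Z i p)"
    by (rule local_frame[of p]) blast
  obtain u where "v = (\<Sum>i\<in>Basis. (u \<bullet> i) *\<^sub>R Z i p)" using Z(2)[OF assms] by blast
  then show ?thesis
    using that[of "\<lambda>q. \<Sum>i\<in>Basis. (u \<bullet> i) *\<^sub>R Z i q"] Z(1)
    by (simp add: vector_field_sum vector_field_scale)
qed

end

section \<open>Connections and traces\<close>

locale connection_manifold = smooth_manifold A
  for A :: "('m::{t2_space,second_countable_topology}, 'e::euclidean_space) chart set" +
  fixes D :: "'m vfield \<Rightarrow> 'm vfield \<Rightarrow> 'm vfield"
  assumes connection: "affine_connection A D"
begin

lemma connection_field: "vector_field A X \<Longrightarrow> vector_field A Y \<Longrightarrow> vector_field A (D X Y)"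
  using connection unfolding affine_connection_def by blast

lemma connection_add_left:
  assumes "vector_field A X" "vector_field A Y" "vector_field A Z"
  shows "D (\<lambda>q. X q + Y q) Z p = D X Z p + D Y Z p"
proof -
  have "D (X + Y) Z = D X Z + D Y Z" using connection assms unfolding affine_connection_def by blast
  then have "D (X + Y) Z p = D X Z p + D Y Z p" by (simp only: plus_fun_apply)
  then show ?thesis by (simp only: plus_fun_def[of X Y])
qed

lemma connection_add_right:
  assumes "vector_field A X" "vector_field A Y" "vector_field A Z"
  shows "D X (\<lambda>q. Y q + Z q) p = D X Y p + D X Z p"
proof -
  have "D X (Y + Z) = D X Y + D X Z" using connection assms unfolding affine_connection_def by blast
  then have "D X (Y + Z) p = D X Y p + D X Z p" by (simp only: plus_fun_apply)
  then show ?thesis by (simp only: plus_fun_def[of Y Z])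
qed

lemma connection_scale_left:
  assumes "smooth_fun A f" "vector_field A X" "vector_field A Y"
  shows "D (\<lambda>q. f q *\<^sub>R X q) Y p = f p *\<^sub>R D X Y p"
proof -
  have "D (\<lambda>q. f q *\<^sub>R X q) Y = (\<lambda>q. f q *\<^sub>R D X Y q)"
    using connection assms unfolding affine_connection_def by blast
  then show ?thesis by simp
qed

lemma connection_scale_right:
  assumes "smooth_fun A f" "vector_field A X" "vector_field A Y"
  shows "D X (\<lambda>q. f q *\<^sub>R Y q) p = X p f *\<^sub>R Y p + f p *\<^sub>R D X Y p"
proof -
  have "D X (\<lambda>q. f q *\<^sub>R Y q) = (\<lambda>q. X q f *\<^sub>R Y q + f q *\<^sub>R D X Y q)"
    using connection assms unfolding affine_connection_def by blast
  then show ?thesis by simp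
qed

lemma connection_zero:
  assumes "vector_field A X"
  shows "D X (\<lambda>q. 0) p = 0" "D (\<lambda>q. 0) X p = 0"
  using connection_add_right[OF assms vector_field_zero vector_field_zero, of p]
    connection_add_left[OF vector_field_zero vector_field_zero assms, of p] by simp_all

lemma connection_diff_right:
  assumes "vector_field A X" "vector_field A Y" "vector_field A Z"
  shows "D X (\<lambda>q. Y q - Z q) p = D X Y p - D X Z p"
  using connection_add_right[OF assms(1) vector_field_diff[OF assms(2,3)] assms(3), of p] by simp

lemma connection_sum_left:
  assumes "finite I" "\<And>i. i \<in> I \<Longrightarrow> vector_field A (X i)" "vector_field A Y"
  shows "D (\<lambda>q. \<Sum>i\<in>I. X i q) Y p = (\<Sum>i\<in>I. D (X i) Y p)"
  using assms(1,2)
proof (induction I rule: finite_induct)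
  case empty
  show ?case by (simp only: sum.empty connection_zero(2)[OF assms(3)])
next
  case (insert i I)
  (* Tangent vectors are functions: the simplifier would evaluate a sum of them pointwise and so
     destroy the arguments of D, unless plus_fun_apply is switched off. *)
  then show ?case
    using connection_add_left[of "X i" "\<lambda>q. \<Sum>i\<in>I. X i q"] assms(3) vector_field_sum[of I X]
    by (simp del: plus_fun_apply zero_fun_apply)
qed

text \<open>For \<open>X p = 0\<close>, multiplication by a function that is 1 at \<open>p\<close> replaces \<open>X\<close> by a combination
  \<open>\<Sum> F\<^sub>i Z\<^sub>i\<close> of global fields with \<open>F\<^sub>i(p) = 0\<close>, to which the linearity of the connection over
  functions applies.\<close>

lemma connection_tensorial:
  assumes X: "vector_field A X" "vector_field A X'" and Y: "vector_field A Y" and eq: "X p = X' p"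
  shows "D X Y p = D X' Y p"
proof -
  have zero: "D X Y p = 0" if X: "vector_field A X" and Xp: "X p = 0" for X
  proof -
    obtain b Z F where b: "smooth_fun A b" "b p = 1" and Z: "\<And>i::'e. vector_field A (Z i)"
      and F: "\<And>i X. vector_field A X \<Longrightarrow> smooth_fun A (F i X)" "\<And>i X. X p = 0 \<Longrightarrow> F i X p = 0"
      and comb: "\<And>X. vector_field A X \<Longrightarrow>
        (\<lambda>q. b q *\<^sub>R X q) = (\<lambda>q. \<Sum>i\<in>Basis. F i X q *\<^sub>R Z i q)"
      by (rule local_frame[of p]) blast
    have "D X Y p = D (\<lambda>q. b q *\<^sub>R X q) Y p"
      by (simp add: connection_scale_left[OF b(1) X Y] b(2))
    also have "\<dots> = (\<Sum>i\<in>Basis. D (\<lambda>q. F i X q *\<^sub>R Z i q) Y p)"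
      unfolding comb[OF X]
      by (rule connection_sum_left) (simp_all add: Y vector_field_scale F X Z)
    also have "\<dots> = 0"
      using connection_scale_left[OF F(1)[OF X] Z Y] F(2)[of X, OF Xp] by simp
    finally show ?thesis .
  qed
  have "D (\<lambda>q. X q - X' q) Y p = 0" using zero vector_field_diff X eq by simp
  moreover have "D X Y p = D (\<lambda>q. (X q - X' q) + X' q) Y p" by simp
  ultimately show ?thesis
    using connection_add_left[OF vector_field_diff[OF X] X(2) Y, of p] by simp
qed

text \<open>So \<open>v \<mapsto> \<nabla>\<^sub>v Y\<close> makes sense for single tangent vectors \<open>v\<close>, and contractions of \<open>\<nabla>Y\<close> become linear
  algebra in the tangent space at \<open>p\<close>.\<close>

lemma covariant_derivative_at_point:
  assumes Y: "vector_field A Y"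
  obtains K where "linear_on_tangent_space A p K" "\<And>u. u \<in> tangent_space A p \<Longrightarrow> K u \<in> tangent_space A p"
    "\<And>X. vector_field A X \<Longrightarrow> D X Y p = K (X p)"
proof -
  define ext where "ext v = (SOME X. vector_field A X \<and> X p = v)" for v
  have ext: "vector_field A (ext v)" "ext v p = v" if "v \<in> tangent_space A p" for v
    using someI_ex[of "\<lambda>X. vector_field A X \<and> X p = v"] tangent_extends[OF that]
    unfolding ext_def by blast+
  define K where "K v = D (ext v) Y p" for v
  have K: "D X Y p = K (X p)" if "vector_field A X" for X
    unfolding K_def using connection_tensorial[OF that _ Y] ext[OF vector_fieldD[OF that]] by metis
  have "K (u + v) = K u + K v" if "u \<in> tangent_space A p" "v \<in> tangent_space A p" for u v
    using connection_add_left[OF ext(1)[OF that(1)] ext(1)[OF that(2)] Y, of p]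
      K[OF vector_field_add[OF ext(1)[OF that(1)] ext(1)[OF that(2)]]]
    by (simp add: ext that K_def[of u] K_def[of v])
  moreover have "K (r *\<^sub>R u) = r *\<^sub>R K u" if "u \<in> tangent_space A p" for r u
    using connection_scale_left[OF smooth_fun_const ext(1)[OF that] Y, of r p]
      K[OF vector_field_scale[OF smooth_fun_const ext(1)[OF that], of r]]
    by (simp add: ext that K_def[of u])
  ultimately have "linear_on_tangent_space A p K" by (simp add: linear_on_tangent_space_def)
  moreover have "K u \<in> tangent_space A p" if "u \<in> tangent_space A p" for u
    unfolding K_def using vector_fieldD connection_field ext(1)[OF that] Y by blast
  ultimately show ?thesis using that K by blast
qed

end

lemma linear_on_tangent_spaceD:
  assumes "linear_on_tangent_space A p L" "u \<in> tangent_space A p"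
  shows "v \<in> tangent_space A p \<Longrightarrow> L (u + v) = L u + L v" "L (r *\<^sub>R u) = r *\<^sub>R L u"
  using assms unfolding linear_on_tangent_space_def by blast+

lemma (in smooth_manifold) linear_on_tangent_space_sum:
  assumes L: "linear_on_tangent_space A p L" and "finite I"
    and "\<And>i. i \<in> I \<Longrightarrow> u i \<in> tangent_space A p"
  shows "L (\<Sum>i\<in>I. r i *\<^sub>R u i) = (\<Sum>i\<in>I. r i *\<^sub>R L (u i))"
  using assms(2,3)
proof (induction I rule: finite_induct)
  case empty
  have "L 0 = 0" using linear_on_tangent_spaceD(2)[OF L tangent_0, of 0] by simp
  then show ?case by (simp only: sum.empty)
next
  case (insert i I)
  then have "L (r i *\<^sub>R u i + (\<Sum>i\<in>I. r i *\<^sub>R u i)) = L (r i *\<^sub>R u i) + L (\<Sum>i\<in>I. r i *\<^sub>R u i)"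
    by (intro linear_on_tangent_spaceD(1)[OF L] tangent_scale tangent_sum) simp_all
  then show ?case
    using insert linear_on_tangent_spaceD(2)[OF L] by (simp del: plus_fun_apply zero_fun_apply)
qed

text \<open>The Gram-Schmidt process for a second inner product \<open>b\<close> on the model space, which will be the
  pullback of a Riemannian metric at a point.\<close>

lemma gram_schmidt:
  fixes b :: "'e::euclidean_space \<Rightarrow> 'e \<Rightarrow> real"
  assumes lin: "\<And>x. linear (b x)" and sym: "\<And>x y. b x y = b y x"
    and pos: "\<And>x. x \<noteq> 0 \<Longrightarrow> b x x > 0"
  shows "\<exists>e :: 'e \<Rightarrow> 'e. \<forall>i\<in>Basis. \<forall>j\<in>Basis. b (e i) (e j) = (if i = j then 1 else 0)"
proof -
  have "finite I \<Longrightarrow> I \<subseteq> Basis \<Longrightarrow>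
      \<exists>e :: 'e \<Rightarrow> 'e. \<forall>i\<in>I. \<forall>j\<in>I. b (e i) (e j) = (if i = j then 1 else 0)" for I
  proof (induction I rule: finite_induct)
    case (insert k I)
    then obtain e where e: "\<And>i j. i \<in> I \<Longrightarrow> j \<in> I \<Longrightarrow> b (e i) (e j) = (if i = j then 1 else 0)"
      by blast
    have "dim (e ` I) \<le> card I"
      using dim_le_card'[of "e ` I"] card_image_le[of I e] insert.hyps(1) by simp
    also have "card I < DIM('e)"
      using insert.hyps insert.prems psubset_card_mono[OF finite_Basis, of I] by blast
    finally have "span (e ` I) \<noteq> UNIV" by (metis dim_UNIV dim_span less_irrefl)
    then obtain x where x: "x \<notin> span (e ` I)" by blast
    define y where "y = x - (\<Sum>i\<in>I. b x (e i) *\<^sub>R e i)"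
    have "(\<Sum>i\<in>I. b x (e i) *\<^sub>R e i) \<in> span (e ` I)"
      by (intro span_sum span_scale span_base imageI)
    then have "y \<noteq> 0" using x y_def by auto
    then have y: "b y y > 0" by (rule pos)
    have orth: "b (e j) y = 0" if j: "j \<in> I" for j
    proof -
      have "b (e j) y = b (e j) x - (\<Sum>i\<in>I. b x (e i) * b (e j) (e i))"
        unfolding y_def
        by (simp add: linear_diff[OF lin] linear_sum[OF lin] linear_scale[OF lin])
      also have "(\<Sum>i\<in>I. b x (e i) * b (e j) (e i)) = b x (e j)"
        using e[OF j] j insert.hyps(1) by (simp add: if_distrib[of "(*) _"] cong: if_cong)
      finally show ?thesis by (simp add: sym)
    qed
    define z where "z = (1 / sqrt (b y y)) *\<^sub>R y"
    have z: "b (e j) z = 0" "b z (e j) = 0" if "j \<in> I" for j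
      using orth[OF that] sym[of z] by (simp_all add: z_def linear_scale[OF lin])
    have "b z z = (1 / sqrt (b y y)) * (1 / sqrt (b y y)) * b y y"
      unfolding z_def using sym by (simp add: linear_scale[OF lin])
    then have zz: "b z z = 1" using y by (simp add: field_simps)
    have "\<forall>i\<in>insert k I. \<forall>j\<in>insert k I.
        b ((e(k := z)) i) ((e(k := z)) j) = (if i = j then 1 else 0)"
      using e z zz insert.hyps(2) by auto
    then show ?case by blast
  qed simp
  then show ?thesis using finite_Basis by blast
qed

locale riemannian_manifold = smooth_manifold A
  for A :: "('m::{t2_space,second_countable_topology}, 'e::euclidean_space) chart set" +
  fixes g :: "'m metric_field"
  assumes metric: "riemannian_metric A g"
begin

lemma metric_linear: "u \<in> tangent_space A p \<Longrightarrow> linear_on_tangent_space A p (g p u)"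
  using metric unfolding riemannian_metric_def by blast

lemma metric_sym: "u \<in> tangent_space A p \<Longrightarrow> v \<in> tangent_space A p \<Longrightarrow> g p u v = g p v u"
  using metric unfolding riemannian_metric_def by blast

lemma metric_pos: "u \<in> tangent_space A p \<Longrightarrow> u \<noteq> 0 \<Longrightarrow> g p u u > 0"
  using metric unfolding riemannian_metric_def by blast

lemma metric_smooth:
  "vector_field A X \<Longrightarrow> vector_field A Y \<Longrightarrow> smooth_fun A (\<lambda>p. g p (X p) (Y p))"
  using metric unfolding riemannian_metric_def by blast

lemma metric_add_right:
  "w \<in> tangent_space A p \<Longrightarrow> u \<in> tangent_space A p \<Longrightarrow> v \<in> tangent_space A p \<Longrightarrow>
    g p w (u + v) = g p w u + g p w v"
  using linear_on_tangent_spaceD(1)[OF metric_linear] by blast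

lemma metric_scale_right:
  "w \<in> tangent_space A p \<Longrightarrow> u \<in> tangent_space A p \<Longrightarrow> g p w (r *\<^sub>R u) = r * g p w u"
  using linear_on_tangent_spaceD(2)[OF metric_linear] by simp

lemma metric_add_left:
  "w \<in> tangent_space A p \<Longrightarrow> u \<in> tangent_space A p \<Longrightarrow> v \<in> tangent_space A p \<Longrightarrow>
    g p (u + v) w = g p u w + g p v w"
  using metric_add_right metric_sym tangent_add by metis

lemma metric_scale_left:
  "w \<in> tangent_space A p \<Longrightarrow> u \<in> tangent_space A p \<Longrightarrow> g p (r *\<^sub>R u) w = r * g p u w"
  using metric_scale_right metric_sym tangent_scale by metis

lemma metric_diff_right:
  assumes "w \<in> tangent_space A p" "u \<in> tangent_space A p" "v \<in> tangent_space A p"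
  shows "g p w (u - v) = g p w u - g p w v"
  using metric_add_right[OF assms(1) tangent_diff[OF assms(2,3)] assms(3)] by simp

lemma metric_diff_left:
  assumes "w \<in> tangent_space A p" "u \<in> tangent_space A p" "v \<in> tangent_space A p"
  shows "g p (u - v) w = g p u w - g p v w"
  using metric_add_left[OF assms(1) tangent_diff[OF assms(2,3)] assms(3)] by simp

lemmas metric_simps = metric_add_right metric_add_left metric_scale_right metric_scale_left
  metric_diff_right metric_diff_left

lemma orthonormal_exists: "\<exists>E. orthonormal_at A g p E"
proof -
  obtain Z :: "'e \<Rightarrow> 'm vfield" where Z: "\<And>i. vector_field A (Z i)"
    and inj: "\<And>u. (\<Sum>i\<in>Basis. (u \<bullet> i) *\<^sub>R Z i p) = 0 \<Longrightarrow> u = 0"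
    by (rule local_frame[of p]) blast
  define T where "T u q = (\<Sum>i\<in>Basis. (u \<bullet> i) *\<^sub>R Z i q)" for u q
  have T: "vector_field A (T u)" for u
    unfolding T_def using Z by (intro vector_field_sum vector_field_scale) simp_all
  note Tp = vector_fieldD[OF T, of _ p]
  have T_add: "T (u + v) p = T u p + T v p" for u v
    by (simp add: T_def inner_add_left scaleR_add_left sum.distrib)
  have T_scale: "T (r *\<^sub>R u) p = r *\<^sub>R T u p" for r u
    by (simp add: T_def scaleR_sum_right)
  define b where "b u v = g p (T u p) (T v p)" for u v
  have "\<exists>e :: 'e \<Rightarrow> 'e. \<forall>i\<in>Basis. \<forall>j\<in>Basis. b (e i) (e j) = (if i = j then 1 else 0)"
  proof (rule gram_schmidt)
    show "linear (b x)" for x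
      by (rule linearI) (simp_all add: b_def T_add T_scale metric_simps Tp)
    show "b x y = b y x" for x y unfolding b_def using metric_sym Tp by blast
    show "b x x > 0" if "x \<noteq> 0" for x
      unfolding b_def using metric_pos[OF Tp, of x] inj[of x] that by (auto simp: T_def)
  qed
  then obtain e :: "'e \<Rightarrow> 'e"
    where "\<forall>i\<in>Basis. \<forall>j\<in>Basis. b (e i) (e j) = (if i = j then 1 else 0)" by blast
  then have "orthonormal_at A g p (\<lambda>i. T (e i))" using T by (simp add: orthonormal_at_def b_def)
  then show ?thesis by blast
qed

text \<open>As the tangent space is a linear image of the model space, \<open>DIM('e)\<close> orthonormal vectors span it:
  their preimages in the model space are independent, hence a basis.\<close>

lemma orthonormal_expansion:
  assumes E: "orthonormal_at A g p E" and y: "y \<in> tangent_space A p"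
  shows "y = (\<Sum>i\<in>Basis. g p y (E i p) *\<^sub>R E i p)"
proof -
  obtain Z :: "'e \<Rightarrow> 'm vfield" where Z: "\<And>i. vector_field A (Z i)"
    and surj: "\<And>v. v \<in> tangent_space A p \<Longrightarrow> \<exists>u. v = (\<Sum>i\<in>Basis. (u \<bullet> i) *\<^sub>R Z i p)"
    by (rule local_frame[of p]) blast
  define T where "T u = (\<Sum>i\<in>Basis. (u \<bullet> i) *\<^sub>R Z i p)" for u
  have T: "linear T"
    by (rule linearI) (simp_all add: T_def inner_add_left scaleR_add_left sum.distrib scaleR_sum_right)
  have Ep: "E i p \<in> tangent_space A p" if "i \<in> Basis" for i
    using E that vector_fieldD unfolding orthonormal_at_def by blast
  have on: "g p (E i p) (E j p) = (if i = j then 1 else 0)" if "i \<in> Basis" "j \<in> Basis" for i j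
    using E that unfolding orthonormal_at_def by blast
  have coeff: "g p (\<Sum>i\<in>Basis. r i *\<^sub>R E i p) (E j p) = r j" if j: "j \<in> Basis" for r j
  proof -
    have "g p (E j p) (\<Sum>i\<in>Basis. r i *\<^sub>R E i p) = (\<Sum>i\<in>Basis. r i * g p (E j p) (E i p))"
      using linear_on_tangent_space_sum[OF metric_linear[OF Ep[OF j]] finite_Basis, of "\<lambda>i. E i p" r] Ep
      by simp
    also have "\<dots> = r j" using on[OF j] j by (simp add: if_distrib[of "(*) _"] cong: if_cong)
    finally show ?thesis
      using metric_sym[OF Ep[OF j] tangent_sum[of Basis "\<lambda>i. r i *\<^sub>R E i p" p]] tangent_scale Ep by simp
  qed
  have "\<forall>i\<in>Basis. \<exists>w. E i p = T w" using surj[OF Ep] by (simp add: T_def)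
  from bchoice[OF this] obtain e where "\<forall>i\<in>Basis. E i p = T (e i)" by (rule exE)
  then have e: "\<And>i. i \<in> Basis \<Longrightarrow> E i p = T (e i)" by simp
  have inj: "inj_on e Basis"
  proof (rule inj_onI)
    fix i j :: 'e assume *: "i \<in> Basis" "j \<in> Basis" "e i = e j"
    then have "E i p = E j p" using e by simp
    then have "g p (E i p) (E j p) = 1" using on[OF *(2) *(2)] by simp
    then show "i = j" using on[OF *(1) *(2)] by (simp split: if_splits)
  qed
  have ind: "independent (e ` Basis)"
  proof (rule independent_if_scalars_zero)
    fix f x assume f: "(\<Sum>x\<in>e ` Basis. f x *\<^sub>R x) = 0" and x: "x \<in> e ` Basis"
    then obtain j where j: "j \<in> Basis" "x = e j" by blast
    have "(\<Sum>i\<in>Basis. f (e i) *\<^sub>R e i) = 0" using f by (simp add: sum.reindex[OF inj])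
    then have "T (\<Sum>i\<in>Basis. f (e i) *\<^sub>R e i) = 0" by (simp add: linear_0[OF T])
    then have "(\<Sum>i\<in>Basis. f (e i) *\<^sub>R E i p) = 0"
      by (simp add: linear_sum[OF T] linear_scale[OF T] e)
    then have "f (e j) = g p 0 (E j p)" using coeff[OF j(1), of "\<lambda>i. f (e i)"] by simp
    also have "\<dots> = 0" using metric_scale_left[OF Ep[OF j(1)] tangent_0, of 0] by simp
    finally show "f x = 0" using j by simp
  qed simp
  have "card (e ` Basis) = DIM('e)" by (rule card_image[OF inj])
  then have span: "span (e ` Basis) = UNIV"
    using card_ge_dim_independent[OF subset_UNIV ind] by (simp add: top.extremum_unique)
  obtain u where "y = T u" using surj[OF y] unfolding T_def by blast
  moreover have "u \<in> span (e ` Basis)" using span by simp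
  then obtain f where "u = (\<Sum>x\<in>e ` Basis. f x *\<^sub>R x)"
    by (auto simp: span_finite)
  ultimately have "y = (\<Sum>i\<in>Basis. f (e i) *\<^sub>R E i p)"
    by (simp add: sum.reindex[OF inj] linear_sum[OF T] linear_scale[OF T] e)
  then show ?thesis using coeff by simp
qed

text \<open>Apply \<open>L\<close> to the expansion of \<open>y\<close> in the basis.\<close>

lemma orthonormal_contraction:
  assumes E: "orthonormal_at A g p E" and L: "linear_on_tangent_space A p L"
    and y: "y \<in> tangent_space A p"
  shows "(\<Sum>i\<in>Basis. g p y (E i p) *\<^sub>R L (E i p)) = L y"
proof -
  have "\<And>i. i \<in> Basis \<Longrightarrow> E i p \<in> tangent_space A p"
    using E vector_fieldD unfolding orthonormal_at_def by blast
  then show ?thesis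
    using linear_on_tangent_space_sum[OF L finite_Basis, of "\<lambda>i. E i p" "\<lambda>i. g p y (E i p)"]
      orthonormal_expansion[OF E y] by simp
qed

text \<open>One basis serves all tensors that are traced at \<open>p\<close>.\<close>

lemma metric_trace_orthonormal:
  obtains E where "orthonormal_at A g p E"
    "\<And>T. metric_trace A g T p = (\<Sum>i\<in>Basis. T (E i) (E i) p)"
  using someI_ex[OF orthonormal_exists[of p]] unfolding metric_trace_def Let_def by blast

end

section \<open>The Levi-Civita connection\<close>

lemma curvature_apply:
  "curvature D X Y Z p = D X (D Y Z) p - D Y (D X Z) p - D (lie_bracket X Y) Z p"
  by (simp only: curvature_def minus_apply)

lemma diff_eq_swap: "a - b = c - d \<Longrightarrow> c - a = d - (b::'a::ab_group_add)"
  by (simp add: algebra_simps)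

locale levi_civita_manifold = riemannian_manifold A g + connection_manifold A D
  for A :: "('m::{t2_space,second_countable_topology}, 'e::euclidean_space) chart set"
    and g :: "'m metric_field" and D :: "'m vfield \<Rightarrow> 'm vfield \<Rightarrow> 'm vfield" +
  assumes levi_civita: "levi_civita_connection A g D"
begin

lemma torsion_free:
  assumes "vector_field A X" "vector_field A Y"
  shows "lie_bracket X Y p = D X Y p - D Y X p"
proof -
  have "D X Y - D Y X = lie_bracket X Y"
    using levi_civita assms unfolding levi_civita_connection_def by blast
  from fun_cong[OF this, of p] show ?thesis by (simp only: minus_apply)
qed

lemma lie_bracket_field:
  assumes "vector_field A X" "vector_field A Y" shows "vector_field A (lie_bracket X Y)"
proof -
  have "lie_bracket X Y = (\<lambda>q. D X Y q - D Y X q)" by (rule ext) (rule torsion_free[OF assms])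
  then show ?thesis using vector_field_diff connection_field assms by simp
qed

lemma metric_derivative:
  assumes "vector_field A X" "vector_field A Y" "vector_field A Z"
  shows "X p (\<lambda>q. g q (Y q) (Z q)) = g p (D X Y p) (Z p) + g p (Y p) (D X Z p)"
  using levi_civita assms unfolding levi_civita_connection_def on_fields_def by blast

lemma tangent_field:
  "vector_field A X \<Longrightarrow> X p \<in> tangent_space A p"
  "vector_field A X \<Longrightarrow> vector_field A Y \<Longrightarrow> D X Y p \<in> tangent_space A p"
  using vector_fieldD connection_field by blast+

text \<open>The difference \<open>S\<close> of two metric torsion-free connections is symmetric in its arguments,
  whereas \<open>g(S(X,Y),Z)\<close> is skew in \<open>Y\<close> and \<open>Z\<close>; alternating the two symmetries gives
  \<open>g(S(X,Y),Z) = - g(S(X,Y),Z)\<close>, and \<open>Z = S(X,Y)\<close> is a permitted choice.\<close>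

lemma levi_civita_unique:
  assumes N: "\<And>X Y. vector_field A X \<Longrightarrow> vector_field A Y \<Longrightarrow> vector_field A (N X Y)"
    and torsion: "\<And>X Y p. vector_field A X \<Longrightarrow> vector_field A Y \<Longrightarrow>
      N X Y p - N Y X p = lie_bracket X Y p"
    and compatible: "\<And>X Y Z p. vector_field A X \<Longrightarrow> vector_field A Y \<Longrightarrow> vector_field A Z \<Longrightarrow>
      X p (\<lambda>q. g q (Y q) (Z q)) = g p (N X Y p) (Z p) + g p (Y p) (N X Z p)"
    and X: "vector_field A X" and Y: "vector_field A Y"
  shows "D X Y p = N X Y p"
proof -
  define S where "S X Y q = D X Y q - N X Y q" for X Y q
  have S: "vector_field A (S X Y)" if "vector_field A X" "vector_field A Y" for X Y
    unfolding S_def by (intro vector_field_diff connection_field N that)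
  have sym: "S X Y p = S Y X p" if "vector_field A X" "vector_field A Y" for X Y
    unfolding S_def by (rule diff_eq_swap) (rule trans[OF torsion[OF that] torsion_free[OF that]])
  have skew: "g p (S X Y p) (Z p) = - g p (S X Z p) (Y p)"
    if f: "vector_field A X" "vector_field A Y" "vector_field A Z" for X Y Z
  proof -
    note t = tangent_field(1)[OF f(2)] tangent_field(1)[OF f(3)]
      tangent_field(2)[OF f(1,2)] tangent_field(2)[OF f(1,3)]
      tangent_field(1)[OF N[OF f(1,2)]] tangent_field(1)[OF N[OF f(1,3)]]
    have "g p (D X Y p) (Z p) + g p (Y p) (D X Z p) = g p (N X Y p) (Z p) + g p (Y p) (N X Z p)"
      using metric_derivative[OF f, of p] compatible[OF f, of p] by simp
    then show ?thesis
      unfolding S_def using t by (simp add: metric_diff_left metric_sym[of "Y p"])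
  qed
  let ?Z = "S X Y"
  have Z: "vector_field A ?Z" using S X Y .
  have "g p (S X Y p) (?Z p) = - g p (S X ?Z p) (Y p)" using skew X Y Z .
  also have "\<dots> = g p (S ?Z Y p) (X p)" using skew[OF Z X Y] sym[OF X Z] by simp
  also have "\<dots> = - g p (S Y X p) (?Z p)" using skew[OF Y Z X] sym[OF Y Z] by simp
  also have "\<dots> = - g p (S X Y p) (?Z p)" using sym[OF X Y] by simp
  finally have "g p (?Z p) (?Z p) = 0" by simp
  then have "?Z p = 0" using metric_pos[OF tangent_field(1)[OF Z], of p] by fastforce
  then show ?thesis by (simp add: S_def)
qed

lemma lie_derivative_metric_eq:
  assumes V: "vector_field A V" and X: "vector_field A X" and Y: "vector_field A Y"
  shows "lie_derivative_metric V g X Y p = g p (D X V p) (Y p) + g p (D Y V p) (X p)"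
  using metric_derivative[OF V X Y, of p]
  by (simp add: lie_derivative_metric_def on_fields_def torsion_free[OF V X] torsion_free[OF V Y]
      metric_diff_left metric_diff_right tangent_field V X Y metric_sym[of "X p"])

end


section \<open>Kenmotsu manifolds\<close>

locale kenmotsu_manifold =
  fixes A :: "('m::{t2_space,second_countable_topology}, 'e::euclidean_space) chart set"
    and \<phi> :: "'m \<Rightarrow> 'm tangent_vector \<Rightarrow> 'm tangent_vector"
    and \<xi> :: "'m vfield" and \<eta> :: "'m \<Rightarrow> 'm tangent_vector \<Rightarrow> real"
    and g :: "'m metric_field" and D :: "'m vfield \<Rightarrow> 'm vfield \<Rightarrow> 'm vfield"
  assumes kenmotsu: "kenmotsu A \<phi> \<xi> \<eta> g D"
begin

lemma contact: "almost_contact_metric A \<phi> \<xi> \<eta> g"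
  using kenmotsu unfolding kenmotsu_def by blast

end

sublocale kenmotsu_manifold \<subseteq> levi_civita_manifold A g D
  using kenmotsu
  by unfold_locales
    (auto simp: kenmotsu_def almost_contact_metric_def levi_civita_connection_def)

context kenmotsu_manifold
begin

lemma xi_field: "vector_field A \<xi>"
  using contact unfolding almost_contact_metric_def by blast

lemma xi_tangent: "\<xi> p \<in> tangent_space A p"
  using vector_fieldD[OF xi_field] .

lemma eta_xi: "\<eta> p (\<xi> p) = 1"
  using contact unfolding almost_contact_metric_def by blast

lemma eta_linear: "linear_on_tangent_space A p (\<eta> p)"
  using contact unfolding almost_contact_metric_def one_form_def by blast

lemma eta_smooth: "vector_field A X \<Longrightarrow> smooth_fun A (\<lambda>q. \<eta> q (X q))"
  using contact unfolding almost_contact_metric_def one_form_def by blast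

lemma eta_metric: "u \<in> tangent_space A p \<Longrightarrow> g p (\<xi> p) u = \<eta> p u"
  using contact unfolding almost_contact_metric_def by metis

lemma eta_metric': "u \<in> tangent_space A p \<Longrightarrow> g p u (\<xi> p) = \<eta> p u"
  using eta_metric metric_sym xi_tangent by metis

lemma eta_add: "u \<in> tangent_space A p \<Longrightarrow> v \<in> tangent_space A p \<Longrightarrow> \<eta> p (u + v) = \<eta> p u + \<eta> p v"
  using linear_on_tangent_spaceD(1)[OF eta_linear] .

lemma eta_scale: "u \<in> tangent_space A p \<Longrightarrow> \<eta> p (r *\<^sub>R u) = r * \<eta> p u"
  using linear_on_tangent_spaceD(2)[OF eta_linear, of u p r] by simp

lemma eta_diff:
  assumes "u \<in> tangent_space A p" "v \<in> tangent_space A p" shows "\<eta> p (u - v) = \<eta> p u - \<eta> p v"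
  using eta_add[OF tangent_diff[OF assms] assms(2)] by simp

lemmas eta_simps = eta_add eta_scale eta_diff eta_xi

lemma phi_linear: "linear_on_tangent_space A p (\<phi> p)"
  using contact unfolding almost_contact_metric_def tensor_field_1_1_def by blast

lemma phi_tangent: "u \<in> tangent_space A p \<Longrightarrow> \<phi> p u \<in> tangent_space A p"
  using contact unfolding almost_contact_metric_def tensor_field_1_1_def by blast

lemma phi_phi: "u \<in> tangent_space A p \<Longrightarrow> \<phi> p (\<phi> p u) = \<eta> p u *\<^sub>R \<xi> p - u"
  using contact unfolding almost_contact_metric_def by (metis uminus_add_conv_diff)

lemma phi_xi: "\<phi> p (\<xi> p) = 0"
proof -
  have "g p (\<phi> p (\<xi> p)) (\<phi> p (\<xi> p)) = g p (\<xi> p) (\<xi> p) - \<eta> p (\<xi> p) * \<eta> p (\<xi> p)"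
    using contact xi_tangent unfolding almost_contact_metric_def by blast
  then have "g p (\<phi> p (\<xi> p)) (\<phi> p (\<xi> p)) = 0" by (simp add: eta_metric xi_tangent eta_xi)
  then show ?thesis using metric_pos[OF phi_tangent[OF xi_tangent], of p] by fastforce
qed

text \<open>Compute \<open>\<phi>\<^sup>3 u\<close> in two ways.\<close>

lemma eta_phi: assumes u: "u \<in> tangent_space A p" shows "\<eta> p (\<phi> p u) = 0"
proof -
  have "\<phi> p (\<eta> p u *\<^sub>R \<xi> p) = 0"
    using linear_on_tangent_spaceD(2)[OF phi_linear xi_tangent] by (simp add: phi_xi)
  moreover have "\<phi> p ((\<eta> p u *\<^sub>R \<xi> p - u) + u) = \<phi> p (\<eta> p u *\<^sub>R \<xi> p - u) + \<phi> p u"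
    using u by (intro linear_on_tangent_spaceD(1)[OF phi_linear] tangent_diff tangent_scale xi_tangent)
  ultimately have "\<phi> p (\<phi> p (\<phi> p u)) + \<phi> p u = 0"
    by (simp add: phi_phi[OF u] del: plus_fun_apply zero_fun_apply)
  then have "\<eta> p (\<phi> p u) *\<^sub>R \<xi> p = 0"
    by (simp add: phi_phi[OF phi_tangent[OF u]] del: plus_fun_apply zero_fun_apply)
  then have "\<eta> p (\<eta> p (\<phi> p u) *\<^sub>R \<xi> p) = \<eta> p (0 *\<^sub>R \<xi> p)"
    by (simp only: scaleR_zero_left)
  then show ?thesis by (simp only: eta_scale[OF xi_tangent]) (simp add: eta_xi)
qed

text \<open>Insert \<open>Y = \<xi>\<close> into the Kenmotsu condition: \<open>\<phi>(\<nabla>\<^sub>X \<xi>) = \<phi> X\<close>, so \<open>\<nabla>\<^sub>X \<xi>\<close> and \<open>X\<close> have the same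
  part orthogonal to \<open>\<xi>\<close>, while \<open>\<nabla>\<^sub>X \<xi>\<close> is itself orthogonal to the unit field \<open>\<xi>\<close>.\<close>

lemma nabla_xi:
  assumes X: "vector_field A X" shows "D X \<xi> p = X p - \<eta> p (X p) *\<^sub>R \<xi> p"
proof -
  note Xp = tangent_field(1)[OF X, of p] and t = tangent_field(2)[OF X xi_field, of p]
  have "D X (\<lambda>q. \<phi> q (\<xi> q)) p - \<phi> p (D X \<xi> p) =
      g p (\<phi> p (X p)) (\<xi> p) *\<^sub>R \<xi> p - \<eta> p (\<xi> p) *\<^sub>R \<phi> p (X p)"
    using kenmotsu X xi_field unfolding kenmotsu_def by blast
  then have "\<phi> p (D X \<xi> p) = \<phi> p (X p)"
    by (simp add: phi_xi connection_zero X eta_metric' phi_tangent Xp eta_phi eta_xi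
        del: plus_fun_apply zero_fun_apply)
  then have "\<phi> p (\<phi> p (D X \<xi> p)) = \<phi> p (\<phi> p (X p))" by simp
  then have *: "\<eta> p (D X \<xi> p) *\<^sub>R \<xi> p - D X \<xi> p = \<eta> p (X p) *\<^sub>R \<xi> p - X p"
    by (simp only: phi_phi[OF t] phi_phi[OF Xp])
  have "X p (\<lambda>q. g q (\<xi> q) (\<xi> q)) = 0"
    by (simp add: eta_metric xi_tangent eta_xi tangent_const[OF Xp])
  then have "\<eta> p (D X \<xi> p) = 0"
    using metric_derivative[OF X xi_field xi_field, of p] t by (simp add: eta_metric eta_metric')
  then show ?thesis using * by (simp add: algebra_simps del: plus_fun_apply zero_fun_apply)
qed

text \<open>The metric of the distribution \<open>ker \<eta>\<close>, extended by 0 to \<open>\<xi>\<close>.\<close>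

definition transverse :: "'m metric_field"
  where "transverse p u v = g p u v - \<eta> p u * \<eta> p v"

text \<open>That is, \<open>\<nabla>\<eta>\<close> is the transverse metric.  Its symmetry means that \<open>\<eta>\<close> is closed.\<close>

lemma eta_derivative:
  assumes X: "vector_field A X" and Y: "vector_field A Y"
  shows "X p (\<lambda>q. \<eta> q (Y q)) = \<eta> p (D X Y p) + transverse p (X p) (Y p)"
proof -
  have "(\<lambda>q. \<eta> q (Y q)) = (\<lambda>q. g q (\<xi> q) (Y q))"
    by (rule ext) (simp add: eta_metric tangent_field Y)
  then have "X p (\<lambda>q. \<eta> q (Y q)) = g p (D X \<xi> p) (Y p) + g p (\<xi> p) (D X Y p)"
    using metric_derivative[OF X xi_field Y] by simp
  then show ?thesis
    by (simp add: nabla_xi X Y transverse_def metric_simps tangent_field tangent_scale xi_tangent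
        eta_metric)
qed

lemma transverse_sym:
  "u \<in> tangent_space A p \<Longrightarrow> v \<in> tangent_space A p \<Longrightarrow> transverse p u v = transverse p v u"
  unfolding transverse_def using metric_sym by simp

lemma transverse_xi:
  "u \<in> tangent_space A p \<Longrightarrow> transverse p u (\<xi> p) = 0"
  "u \<in> tangent_space A p \<Longrightarrow> transverse p (\<xi> p) u = 0"
  unfolding transverse_def by (simp_all add: eta_metric eta_metric' eta_xi)

lemma transverse_simps:
  assumes "u \<in> tangent_space A p" "v \<in> tangent_space A p"
  shows "w \<in> tangent_space A p \<Longrightarrow> transverse p u (v + w) = transverse p u v + transverse p u w"
    "transverse p u (r *\<^sub>R v) = r * transverse p u v"
    "w \<in> tangent_space A p \<Longrightarrow> transverse p (v - w) u = transverse p v u - transverse p w u"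
  using assms by (simp_all add: transverse_def metric_simps eta_simps algebra_simps)

lemma transverse_smooth:
  "vector_field A X \<Longrightarrow> vector_field A Y \<Longrightarrow> smooth_fun A (\<lambda>q. transverse q (X q) (Y q))"
  unfolding transverse_def
  by (intro smooth_fun_diff smooth_fun_mult metric_smooth eta_smooth)

lemma transverse_derivative:
  assumes X: "vector_field A X" and Y: "vector_field A Y" and Z: "vector_field A Z"
  shows "X p (\<lambda>q. transverse q (Y q) (Z q)) =
    transverse p (D X Y p) (Z p) + transverse p (Y p) (D X Z p)
    - transverse p (X p) (Y p) * \<eta> p (Z p) - \<eta> p (Y p) * transverse p (X p) (Z p)"
  unfolding transverse_def
    tangent_fun_diff[OF tangent_field(1)[OF X] metric_smooth[OF Y Z]
      smooth_fun_mult[OF eta_smooth[OF Y] eta_smooth[OF Z]]]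
    tangent_fun_mult[OF tangent_field(1)[OF X] eta_smooth[OF Y] eta_smooth[OF Z]]
  by (simp add: metric_derivative eta_derivative X Y Z transverse_def algebra_simps)

lemma connection_scaled_xi:
  assumes X: "vector_field A X" and f: "smooth_fun A f"
  shows "D X (\<lambda>q. f q *\<^sub>R \<xi> q) p = (X p f - f p * \<eta> p (X p)) *\<^sub>R \<xi> p + f p *\<^sub>R X p"
  unfolding connection_scale_right[OF f X xi_field] nabla_xi[OF X]
  by (simp add: algebra_simps del: plus_fun_apply)

text \<open>Differentiate \<open>\<nabla>\<^sub>Y \<xi> = Y - \<eta>(Y) \<xi>\<close> once more; what is left of the derivatives of \<open>\<eta>\<close> after
  antisymmetrization cancels because \<open>\<eta>\<close> is closed.\<close>

lemma curvature_xi: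
  assumes X: "vector_field A X" and Y: "vector_field A Y"
  shows "curvature D X Y \<xi> p = \<eta> p (X p) *\<^sub>R Y p - \<eta> p (Y p) *\<^sub>R X p"
proof -
  have twice: "D X (D Y \<xi>) p =
      D X Y p - ((\<eta> p (D X Y p) + transverse p (X p) (Y p) - \<eta> p (Y p) * \<eta> p (X p)) *\<^sub>R \<xi> p
        + \<eta> p (Y p) *\<^sub>R X p)" if X: "vector_field A X" and Y: "vector_field A Y" for X Y
  proof -
    have "D Y \<xi> = (\<lambda>q. Y q - \<eta> q (Y q) *\<^sub>R \<xi> q)" by (rule ext) (rule nabla_xi[OF Y])
    then show ?thesis
      using connection_diff_right[OF X Y vector_field_scale[OF eta_smooth[OF Y] xi_field], of p]
        connection_scaled_xi[OF X eta_smooth[OF Y], of p] eta_derivative[OF X Y, of p] by simp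
  qed
  note t = tangent_field[OF X] tangent_field[OF Y] tangent_field(2)[OF X Y] tangent_field(2)[OF Y X]
  show ?thesis
    unfolding curvature_apply twice[OF X Y] twice[OF Y X] nabla_xi[OF lie_bracket_field[OF X Y]]
      torsion_free[OF X Y]
    using transverse_sym[OF t(1) t(3), of p]
    by (simp add: eta_diff t algebra_simps del: plus_fun_apply)
qed

lemma ricci_xi_xi: "ricci A g D \<xi> \<xi> p = 1 - real DIM('e)"
proof -
  obtain E where E: "orthonormal_at A g p E"
    and trace: "\<And>T. metric_trace A g T p = (\<Sum>i\<in>Basis. T (E i) (E i) p)"
    using metric_trace_orthonormal[of p] by blast
  have Ef: "vector_field A (E i)" "g p (E i p) (E i p) = 1" if "i \<in> Basis" for i
    using E that unfolding orthonormal_at_def by simp_all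
  have "riemann_tensor g D (E i) \<xi> \<xi> (E i) p = g p (\<xi> p) (E i p) *\<^sub>R \<eta> p (E i p) - 1"
    if "i \<in> Basis" for i
    using Ef[OF that]
    by (simp add: riemann_tensor_def on_fields_def curvature_xi xi_field metric_simps tangent_field
        tangent_scale xi_tangent eta_metric eta_xi)
  then have "ricci A g D \<xi> \<xi> p = (\<Sum>i\<in>Basis. g p (\<xi> p) (E i p) *\<^sub>R \<eta> p (E i p) - 1)"
    unfolding ricci_def trace by simp
  then show ?thesis
    using orthonormal_contraction[OF E eta_linear xi_tangent] by (simp add: sum_subtractf eta_xi)
qed

end

section \<open>The deformed structure\<close>

context kenmotsu_manifold
begin

definition deformed_metric :: "real \<Rightarrow> 'm metric_field"
  where "deformed_metric a p u v = a * g p u v + a * (a - 1) * \<eta> p u * \<eta> p v"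

end

locale deformed_kenmotsu = kenmotsu_manifold A \<phi> \<xi> \<eta> g D
  for A :: "('m::{t2_space,second_countable_topology}, 'e::euclidean_space) chart set"
    and \<phi> \<xi> \<eta> g D +
  fixes a :: real and D' :: "'m vfield \<Rightarrow> 'm vfield \<Rightarrow> 'm vfield"
  assumes a: "a > 0"
    and deformed_riemannian: "riemannian_metric A (deformed_metric a)"
    and deformed_levi_civita: "levi_civita_connection A (deformed_metric a) D'"

sublocale deformed_kenmotsu \<subseteq> deformed: levi_civita_manifold A "deformed_metric a" D'
  using deformed_riemannian deformed_levi_civita
  by unfold_locales (auto simp: levi_civita_connection_def)

context deformed_kenmotsu
begin

abbreviation (input) c :: real where "c \<equiv> (a - 1) / a"

text \<open>The right hand side is torsion-free because the transverse metric is symmetric.  The coefficient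
  is forced by compatibility with the metric: along \<open>\<xi>\<close> one needs
  \<open>a c + a (a - 1) c = a (a - 1)\<close>.\<close>

lemma deformed_connection:
  assumes X: "vector_field A X" and Y: "vector_field A Y"
  shows "D' X Y p = D X Y p + (c * transverse p (X p) (Y p)) *\<^sub>R \<xi> p"
proof (rule deformed.levi_civita_unique[OF _ _ _ X Y])
  fix X Y assume X: "vector_field A X" and Y: "vector_field A Y"
  show "vector_field A (\<lambda>p. D X Y p + (c * transverse p (X p) (Y p)) *\<^sub>R \<xi> p)"
    by (intro vector_field_add connection_field vector_field_scale smooth_fun_mult smooth_fun_const
        transverse_smooth xi_field X Y)
  show "D X Y p + (c * transverse p (X p) (Y p)) *\<^sub>R \<xi> p -
      (D Y X p + (c * transverse p (Y p) (X p)) *\<^sub>R \<xi> p) = lie_bracket X Y p" for p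
    by (simp add: torsion_free X Y transverse_sym[of "Y p"] tangent_field del: plus_fun_apply)
next
  fix X Y Z p assume X: "vector_field A X" and Y: "vector_field A Y" and Z: "vector_field A Z"
  note t = tangent_field(1)[OF X, of p] tangent_field(1)[OF Y, of p] tangent_field(1)[OF Z, of p]
    tangent_field(2)[OF X Y, of p] tangent_field(2)[OF X Z, of p] xi_tangent[of p]
  have "X p (\<lambda>q. deformed_metric a q (Y q) (Z q)) =
      X p (\<lambda>q. a * g q (Y q) (Z q) + a * (a - 1) * (\<eta> q (Y q) * \<eta> q (Z q)))"
    by (simp add: deformed_metric_def mult.assoc)
  also have "\<dots> = a * X p (\<lambda>q. g q (Y q) (Z q)) + a * (a - 1) * X p (\<lambda>q. \<eta> q (Y q) * \<eta> q (Z q))"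
    using tangent_fun_add[OF t(1) smooth_fun_mult[OF smooth_fun_const metric_smooth[OF Y Z]]
        smooth_fun_mult[OF smooth_fun_const smooth_fun_mult[OF eta_smooth[OF Y] eta_smooth[OF Z]]],
        of a "a * (a - 1)"]
    by (simp only: tangent_fun_cmult[OF t(1) metric_smooth[OF Y Z]]
        tangent_fun_cmult[OF t(1) smooth_fun_mult[OF eta_smooth[OF Y] eta_smooth[OF Z]]])
  also have "\<dots> = a * (g p (D X Y p) (Z p) + g p (Y p) (D X Z p))
      + a * (a - 1) * (\<eta> p (Y p) * (\<eta> p (D X Z p) + transverse p (X p) (Z p))
        + (\<eta> p (D X Y p) + transverse p (X p) (Y p)) * \<eta> p (Z p))"
    by (simp only: metric_derivative[OF X Y Z] tangent_fun_mult[OF t(1) eta_smooth[OF Y] eta_smooth[OF Z]]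
        eta_derivative[OF X Y] eta_derivative[OF X Z])
  also have "\<dots> = deformed_metric a p (D X Y p + (c * transverse p (X p) (Y p)) *\<^sub>R \<xi> p) (Z p)
      + deformed_metric a p (Y p) (D X Z p + (c * transverse p (X p) (Z p)) *\<^sub>R \<xi> p)"
    using a by (simp add: deformed_metric_def metric_simps eta_simps tangent_add tangent_scale t
        eta_metric eta_metric' field_simps del: plus_fun_apply)
  finally show "X p (\<lambda>q. deformed_metric a q (Y q) (Z q)) =
      deformed_metric a p (D X Y p + (c * transverse p (X p) (Y p)) *\<^sub>R \<xi> p) (Z p)
      + deformed_metric a p (Y p) (D X Z p + (c * transverse p (X p) (Z p)) *\<^sub>R \<xi> p)" .
qed

lemma deformed_second_derivative:
  assumes X: "vector_field A X" and Y: "vector_field A Y" and Z: "vector_field A Z"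
  shows "D' X (D' Y Z) p = D X (D Y Z) p
    + (c * (transverse p (D X Y p) (Z p) + transverse p (Y p) (D X Z p)
      - transverse p (X p) (Y p) * \<eta> p (Z p) - \<eta> p (Y p) * transverse p (X p) (Z p)
      - \<eta> p (X p) * transverse p (Y p) (Z p) + transverse p (X p) (D Y Z p))) *\<^sub>R \<xi> p
    + (c * transverse p (Y p) (Z p)) *\<^sub>R X p"
proof -
  define f where "f q = c * transverse q (Y q) (Z q)" for q
  define W where "W q = D Y Z q + f q *\<^sub>R \<xi> q" for q
  have f: "smooth_fun A f"
    unfolding f_def by (intro smooth_fun_mult smooth_fun_const transverse_smooth Y Z)
  have YZ: "vector_field A (D Y Z)" using connection_field Y Z .
  have fx: "vector_field A (\<lambda>q. f q *\<^sub>R \<xi> q)" using vector_field_scale f xi_field .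
  have W: "vector_field A W" unfolding W_def using vector_field_add YZ fx .
  have "D' Y Z = W" unfolding W_def f_def by (rule ext) (rule deformed_connection[OF Y Z])
  then have "D' X (D' Y Z) p = D X W p + (c * transverse p (X p) (W p)) *\<^sub>R \<xi> p"
    using deformed_connection[OF X W] by simp
  moreover have "D X W p = D X (D Y Z) p + ((X p f - f p * \<eta> p (X p)) *\<^sub>R \<xi> p + f p *\<^sub>R X p)"
    unfolding W_def using connection_add_right[OF X YZ fx, of p] connection_scaled_xi[OF X f, of p]
    by (simp only:)
  moreover have "X p f = c * X p (\<lambda>q. transverse q (Y q) (Z q))"
    unfolding f_def by (rule tangent_fun_cmult[OF tangent_field(1)[OF X] transverse_smooth[OF Y Z]])
  moreover have "transverse p (X p) (W p) = transverse p (X p) (D Y Z p)"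
    unfolding W_def
    by (simp add: transverse_simps tangent_field X YZ tangent_scale xi_tangent transverse_xi
        del: plus_fun_apply)
  ultimately have "D' X (D' Y Z) p = D X (D Y Z) p
      + ((c * X p (\<lambda>q. transverse q (Y q) (Z q)) - f p * \<eta> p (X p)) *\<^sub>R \<xi> p + f p *\<^sub>R X p)
      + (c * transverse p (X p) (D Y Z p)) *\<^sub>R \<xi> p"
    by (simp only:)
  then show ?thesis
    unfolding transverse_derivative[OF X Y Z] f_def
    by (simp add: algebra_simps del: plus_fun_apply)
qed

text \<open>The components of the difference along \<open>\<xi>\<close> cancel.  With \<open>h\<close> for the transverse metric,
  \<open>(\<nabla>\<^sub>X h)(Y,Z) - (\<nabla>\<^sub>Y h)(X,Z) = \<eta>(X) h(Y,Z) - \<eta>(Y) h(X,Z)\<close>, and the terms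
  \<open>h(Y,Z) \<nabla>\<^sub>X \<xi> - h(X,Z) \<nabla>\<^sub>Y \<xi>\<close> contribute the negative of this to the component along \<open>\<xi>\<close>.\<close>

lemma deformed_curvature:
  assumes X: "vector_field A X" and Y: "vector_field A Y" and Z: "vector_field A Z"
  shows "curvature D' X Y Z p = curvature D X Y Z p
    + ((c * transverse p (Y p) (Z p)) *\<^sub>R X p - (c * transverse p (X p) (Z p)) *\<^sub>R Y p)"
proof -
  have regroup: "P + r *\<^sub>R w + x - (Q + s *\<^sub>R w + y) - (R + t *\<^sub>R w) = P - Q - R + (x - y)"
    if "r - s - t = 0" for P Q R w x y :: "'m tangent_vector" and r s t :: real
  proof -
    have "P + r *\<^sub>R w + x - (Q + s *\<^sub>R w + y) - (R + t *\<^sub>R w) =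
        P - Q - R + (x - y) + (r - s - t) *\<^sub>R w"
      by (simp add: algebra_simps del: plus_fun_apply)
    then show ?thesis using that by (simp del: plus_fun_apply zero_fun_apply)
  qed
  have bracket: "D' (lie_bracket X Y) Z p = D (lie_bracket X Y) Z p
      + (c * (transverse p (D X Y p) (Z p) - transverse p (D Y X p) (Z p))) *\<^sub>R \<xi> p"
    unfolding deformed_connection[OF lie_bracket_field[OF X Y] Z] torsion_free[OF X Y]
    by (simp only: transverse_simps(3)[OF tangent_field(1)[OF Z] tangent_field(2)[OF X Y]
          tangent_field(2)[OF Y X]])
  show ?thesis
    unfolding curvature_apply deformed_second_derivative[OF X Y Z]
      deformed_second_derivative[OF Y X Z] bracket
    by (rule regroup)
      (simp add: transverse_sym[OF tangent_field(1)[OF Y] tangent_field(1)[OF X]] algebra_simps)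
qed

section \<open>Contraction of the soliton equation\<close>

text \<open>As \<open>\<eta>\<close> is closed, \<open>L\<^sub>V \<eta>\<close> is the differential of \<open>\<eta>(V)\<close>.\<close>

lemma deformed_lie_derivative:
  assumes V: "vector_field A V" and X: "vector_field A X" and Y: "vector_field A Y"
  shows "1 / 2 * lie_derivative_metric V (deformed_metric a) X Y p =
    a / 2 * (g p (D X V p) (Y p) + g p (D Y V p) (X p))
    + a * (a - 1) / 2 * (\<eta> p (Y p) * X p (\<lambda>q. \<eta> q (V q)) + \<eta> p (X p) * Y p (\<lambda>q. \<eta> q (V q)))"
  unfolding deformed.lie_derivative_metric_eq[OF V X Y] deformed_connection[OF X V]
    deformed_connection[OF Y V] eta_derivative[OF X V] eta_derivative[OF Y V]
  using a by (simp add: deformed_metric_def metric_simps eta_simps tangent_field X Y V tangent_scale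
      xi_tangent eta_metric field_simps del: plus_fun_apply)

text \<open>Let \<open>N\<close> be the dimension and \<open>T = 1/2 L\<^sub>V g'\<close>.  The contraction of the Kulkarni-Nomizu product of
  \<open>T\<close> and \<open>g'\<close> is \<open>tr(T) g' + (N - 2) T\<close>, that of \<open>g'\<close> with itself is \<open>2 (N - 1) g'\<close>, and the
  correction to the curvature contracts to \<open>c (N - 1) h\<close>.  The trace of \<open>T\<close> is the divergence
  of \<open>V\<close>.  The contraction is with \<open>g'\<close>, but \<open>Ric\<close> is a sum over a \<open>g\<close>-orthonormal basis
  \<open>E\<^sub>i\<close>; therefore the soliton equation is evaluated at \<open>(E\<^sub>i, Y, Z, W\<^sub>i)\<close>, where
  \<open>g'(u, W\<^sub>i) = g(u, E\<^sub>i)\<close> for all \<open>u\<close>.\<close>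

lemma soliton_ricci:
  assumes V: "vector_field A V" and div: "divergence A g D V p = 0"
    and soliton: "\<And>X Y Z W. vector_field A X \<Longrightarrow> vector_field A Y \<Longrightarrow> vector_field A Z \<Longrightarrow>
      vector_field A W \<Longrightarrow>
      kulkarni_nomizu (\<lambda>X Y p. 1 / 2 * lie_derivative_metric V (deformed_metric a) X Y p)
        (on_fields (deformed_metric a)) X Y Z W p
      + riemann_tensor (deformed_metric a) D' X Y Z W p =
      lam / 2 * kulkarni_nomizu (on_fields (deformed_metric a)) (on_fields (deformed_metric a)) X Y Z W p"
    and Y: "vector_field A Y" and Z: "vector_field A Z"
  shows "ricci A g D Y Z p =
    (real DIM('e) - 1) * lam * deformed_metric a p (Y p) (Z p)
    - (real DIM('e) - 2) * (1 / 2 * lie_derivative_metric V (deformed_metric a) Y Z p)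
    - (real DIM('e) - 1) * c * transverse p (Y p) (Z p)"
proof -
  let ?g' = "deformed_metric a p" and ?h = "transverse p" and ?\<sigma> = "\<lambda>q. \<eta> q (V q)"
  define y z s where "y = Y p" and "z = Z p" and "s = \<xi> p ?\<sigma>"
  have y: "y \<in> tangent_space A p" and z: "z \<in> tangent_space A p"
    unfolding y_def z_def using tangent_field Y Z by auto
  obtain E where E: "orthonormal_at A g p E"
    and trace: "\<And>T. metric_trace A g T p = (\<Sum>i\<in>Basis. T (E i) (E i) p)"
    using metric_trace_orthonormal[of p] by blast
  obtain K where K: "linear_on_tangent_space A p K"
    "\<And>u. u \<in> tangent_space A p \<Longrightarrow> K u \<in> tangent_space A p"
    "\<And>X. vector_field A X \<Longrightarrow> D X V p = K (X p)"
    using covariant_derivative_at_point[OF V] by blast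
  define e where "e i = E i p" for i
  have Ef: "vector_field A (E i)" and e1: "g p (e i) (e i) = 1" if "i \<in> Basis" for i
    using E that unfolding orthonormal_at_def e_def by simp_all
  have e: "e i \<in> tangent_space A p" if "i \<in> Basis" for i
    unfolding e_def using tangent_field(1)[OF Ef[OF that]] .
  have contract: "(\<Sum>i\<in>Basis. g p u (e i) * L (e i)) = L u"
    if "linear_on_tangent_space A p L" "u \<in> tangent_space A p" for L u
    unfolding e_def using orthonormal_contraction[OF E that] by simp

  define T where "T u v = a / 2 * (g p (K u) v + g p (K v) u)
    + a * (a - 1) / 2 * (\<eta> p v * u ?\<sigma> + \<eta> p u * v ?\<sigma>)" for u v
  have lie: "1 / 2 * lie_derivative_metric V (deformed_metric a) X W p = T (X p) (W p)"
    if "vector_field A X" "vector_field A W" for X W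
    unfolding deformed_lie_derivative[OF V that] K(3)[OF that(1)] K(3)[OF that(2)] T_def ..
  have T_sym: "T u v = T v u" for u v unfolding T_def by (simp add: algebra_simps)
  have scale_apply: "(r *\<^sub>R u) ?\<sigma> = r * u ?\<sigma>" for r and u :: "'m tangent_vector"
    by (simp add: scaleR_fun_def)
  have T_linear: "linear_on_tangent_space A p (T u)" if u: "u \<in> tangent_space A p" for u
    unfolding linear_on_tangent_space_def T_def
    by (simp add: u linear_on_tangent_spaceD[OF K(1)] metric_simps eta_simps K(2) algebra_simps
        scale_apply)
  have h_linear: "linear_on_tangent_space A p (?h u)" if "u \<in> tangent_space A p" for u
    unfolding linear_on_tangent_space_def by (simp add: transverse_simps that)
  have g'_linear: "linear_on_tangent_space A p (?g' u)" if "u \<in> tangent_space A p" for u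
    using deformed.metric_linear that .
  have K_xi: "\<eta> p (K (\<xi> p)) = s"
    using eta_derivative[OF xi_field V, of p] K(3)[OF xi_field] transverse_xi(2)[OF tangent_field(1)[OF V]]
    by (simp add: s_def)
  have T_xi: "T (\<xi> p) (\<xi> p) = a\<^sup>2 * s"
    unfolding T_def
    by (simp add: eta_metric' K(2) xi_tangent K_xi eta_xi s_def[symmetric] power2_eq_square field_simps)

  \<comment> \<open>The value of \<open>\<kappa>\<close> is the one for which \<open>g'(\<xi>, W\<^sub>i) = g(\<xi>, E\<^sub>i)\<close>.\<close>
  define \<kappa> where "\<kappa> = (a - 1) / a\<^sup>2"
  define W where "W i q = (1 / a) *\<^sub>R E i q - (\<kappa> * \<eta> q (E i q)) *\<^sub>R \<xi> q" for i q
  have W: "vector_field A (W i)" if "i \<in> Basis" for i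
    unfolding W_def
    by (intro vector_field_diff vector_field_scale smooth_fun_mult smooth_fun_const eta_smooth
        xi_field Ef that)
  have W_p: "W i p = (1 / a) *\<^sub>R e i - (\<kappa> * \<eta> p (e i)) *\<^sub>R \<xi> p" for i by (simp add: W_def e_def)
  have dual: "?g' u (W i p) = g p u (e i)" if "i \<in> Basis" "u \<in> tangent_space A p" for i u
    using a unfolding W_p \<kappa>_def
    by (simp add: deformed_metric_def metric_simps eta_simps that e tangent_scale xi_tangent
        eta_metric' field_simps power2_eq_square)
  have L_W: "L (W i p) = (1 / a) * L (e i) - \<kappa> * \<eta> p (e i) * L (\<xi> p)"
    if L: "linear_on_tangent_space A p L" and i: "i \<in> Basis" for L :: "_ \<Rightarrow> real" and i
  proof -
    have "W i p = (1 / a) *\<^sub>R e i + (- (\<kappa> * \<eta> p (e i))) *\<^sub>R \<xi> p"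
      unfolding W_p by (simp del: plus_fun_apply)
    then have "L (W i p) = L ((1 / a) *\<^sub>R e i) + L ((- (\<kappa> * \<eta> p (e i))) *\<^sub>R \<xi> p)"
      by (simp only: linear_on_tangent_spaceD(1)[OF L tangent_scale[OF e[OF i]] tangent_scale[OF xi_tangent]])
    then show ?thesis
      unfolding linear_on_tangent_spaceD(2)[OF L e[OF i]] linear_on_tangent_spaceD(2)[OF L xi_tangent]
      by simp
  qed

  have eta_e: "\<eta> p (e i) = g p (\<xi> p) (e i)" if "i \<in> Basis" for i
    using eta_metric[OF e[OF that]] by simp
  have sum_eta: "(\<Sum>i\<in>Basis. \<eta> p (e i) * L (e i)) = L (\<xi> p)"
    if "linear_on_tangent_space A p L" for L :: "_ \<Rightarrow> real"
    using contract[OF that xi_tangent] by (simp add: eta_e)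
  have sigma_linear: "linear_on_tangent_space A p (\<lambda>u. u ?\<sigma>)"
    unfolding linear_on_tangent_space_def by (simp add: scale_apply)
  \<comment> \<open>The \<open>g\<close>-trace of \<open>T\<close> need not vanish; the correction terms in \<open>W\<^sub>i\<close> make up for it.\<close>
  have "(\<Sum>i\<in>Basis. g p (K (e i)) (e i)) = 0"
  proof -
    have "(\<Sum>i\<in>Basis. g p (K (e i)) (e i)) = divergence A g D V p"
      unfolding divergence_def trace by (simp add: on_fields_def K(3) Ef e_def)
    then show ?thesis using div by simp
  qed
  then have trace_T: "(\<Sum>i\<in>Basis. T (e i) (e i)) = a * (a - 1) * s"
    using sum_eta[OF sigma_linear]
    by (simp add: T_def sum.distrib s_def flip: sum_distrib_left)
  have "(\<Sum>i\<in>Basis. T (e i) (W i p)) =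
      (1 / a) * (\<Sum>i\<in>Basis. T (e i) (e i)) - \<kappa> * (\<Sum>i\<in>Basis. \<eta> p (e i) * T (\<xi> p) (e i))"
    by (simp add: L_W[OF T_linear[OF e]] T_sym[of "\<xi> p"] sum_subtractf sum_distrib_left mult.assoc)
  also have "\<dots> = 0"
    unfolding trace_T sum_eta[OF T_linear[OF xi_tangent]] T_xi \<kappa>_def using a by simp
  finally have sum1: "(\<Sum>i\<in>Basis. T (e i) (W i p)) = 0" .

  have sum2: "(\<Sum>i\<in>Basis. T y (W i p) * ?g' (e i) z) = T y z"
  proof -
    have "T y (W i p) * ?g' (e i) z =
        g p z (e i) * T y (e i) + (a - 1) * \<eta> p z * (\<eta> p (e i) * T y (e i))
        - \<kappa> * a * T y (\<xi> p) * (g p z (e i) * \<eta> p (e i))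
        - \<kappa> * a * (a - 1) * \<eta> p z * T y (\<xi> p) * (\<eta> p (e i) * \<eta> p (e i))"
      if i: "i \<in> Basis" for i
      using a unfolding L_W[OF T_linear[OF y] i] deformed_metric_def metric_sym[OF e[OF i] z]
      by (simp add: field_simps)
    then have "(\<Sum>i\<in>Basis. T y (W i p) * ?g' (e i) z) =
        T y z + (a - 1) * \<eta> p z * T y (\<xi> p)
        - \<kappa> * a * T y (\<xi> p) * \<eta> p z - \<kappa> * a * (a - 1) * \<eta> p z * T y (\<xi> p) * \<eta> p (\<xi> p)"
      by (simp add: sum.distrib sum_subtractf contract[OF T_linear[OF y] z] sum_eta[OF T_linear[OF y]]
          contract[OF eta_linear z] sum_eta[OF eta_linear] flip: sum_distrib_left)
    then show ?thesis using a by (simp add: eta_xi \<kappa>_def field_simps power2_eq_square)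
  qed

  \<comment> \<open>A name for \<open>c\<close>, so that the simplifier leaves the quotient alone while sums are rearranged.\<close>
  define k where "k = c"
  have point: "T (e i) (W i p) * ?g' y z + T y z - g p y (e i) * T z (e i) - T y (W i p) * ?g' (e i) z
      + (riemann_tensor g D (E i) Y Z (E i) p + k * ?h y z - k * (g p y (e i) * ?h z (e i)))
      = lam * (?g' y z - g p y (e i) * ?g' z (e i))" if i: "i \<in> Basis" for i
  proof -
    have R: "curvature D' (E i) Y Z p \<in> tangent_space A p" "curvature D (E i) Y Z p \<in> tangent_space A p"
      unfolding curvature_apply
      by (intro tangent_diff vector_fieldD connection_field deformed.connection_field
          lie_bracket_field Ef i Y Z)+
    have "riemann_tensor (deformed_metric a) D' (E i) Y Z (W i) p = g p (curvature D' (E i) Y Z p) (e i)"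
      unfolding riemann_tensor_def on_fields_def by (rule dual[OF i R(1)])
    also have "\<dots> = riemann_tensor g D (E i) Y Z (E i) p + k * ?h y z - k * (g p y (e i) * ?h z (e i))"
      unfolding deformed_curvature[OF Ef[OF i] Y Z] riemann_tensor_def on_fields_def
        e_def[symmetric] y_def[symmetric] z_def[symmetric] k_def[symmetric]
      by (simp add: metric_simps R(2) e i y z tangent_scale tangent_diff e1 transverse_sym[of "e i"]
          mult_ac del: plus_fun_apply)
    finally have riem: "riemann_tensor (deformed_metric a) D' (E i) Y Z (W i) p = \<dots>" .
    have "T (e i) (W i p) * ?g' y z + T y z * ?g' (e i) (W i p) - T (e i) z * ?g' y (W i p)
        - T y (W i p) * ?g' (e i) z + riemann_tensor (deformed_metric a) D' (E i) Y Z (W i) p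
        = lam * (?g' (e i) (W i p) * ?g' y z - ?g' (e i) z * ?g' y (W i p))"
      using soliton[OF Ef[OF i] Y Z W[OF i]]
      unfolding kulkarni_nomizu_def lie[OF Ef[OF i] W[OF i]] lie[OF Y Z] lie[OF Ef[OF i] Z]
        lie[OF Y W[OF i]] on_fields_def e_def y_def z_def
      by (simp add: algebra_simps)
    then show ?thesis
      unfolding riem dual[OF i e[OF i]] dual[OF i y] e1[OF i]
      using T_sym[of "e i" z] deformed.metric_sym[OF e[OF i] z] by (simp add: mult_ac)
  qed
  have "(\<Sum>i\<in>Basis. T (e i) (W i p) * ?g' y z + T y z - g p y (e i) * T z (e i) - T y (W i p) * ?g' (e i) z
      + (riemann_tensor g D (E i) Y Z (E i) p + k * ?h y z - k * (g p y (e i) * ?h z (e i))))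
      = (\<Sum>i\<in>Basis. lam * (?g' y z - g p y (e i) * ?g' z (e i)))"
    by (rule sum.cong[OF refl point])
  then have "(\<Sum>i\<in>Basis. T (e i) (W i p)) * ?g' y z + real DIM('e) * T y z - T z y - T y z
      + (ricci A g D Y Z p + real DIM('e) * k * ?h y z - k * ?h z y)
      = lam * (real DIM('e) * ?g' y z - ?g' z y)"
    unfolding ricci_def trace
    by (simp add: sum.distrib sum_subtractf sum2 contract[OF T_linear[OF z] y] contract[OF h_linear[OF z] y]
        contract[OF g'_linear[OF z] y] flip: sum_distrib_left sum_distrib_right)
  then show ?thesis
    unfolding lie[OF Y Z] y_def[symmetric] z_def[symmetric] k_def[symmetric]
    using sum1 T_sym[of z y] transverse_sym[OF z y] deformed.metric_sym[OF z y]
    by (simp add: algebra_simps)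
qed

end

section \<open>The soliton equation on a deformed Kenmotsu manifold\<close>

theorem theorem3p5:
  fixes A :: "('m::{t2_space,second_countable_topology}, 'e::euclidean_space) chart set"
    and \<phi> \<phi>' :: "'m \<Rightarrow> 'm tangent_vector \<Rightarrow> 'm tangent_vector"
    and \<xi> \<xi>' V :: "'m vfield"
    and \<eta> \<eta>' :: "'m \<Rightarrow> 'm tangent_vector \<Rightarrow> real"
    and g g' :: "'m metric_field"
    and nabla nabla' :: "'m vfield \<Rightarrow> 'm vfield \<Rightarrow> 'm vfield"
    and lam' :: "'m \<Rightarrow> real"
    and a :: real and n :: nat
  assumes n: "n \<ge> 1" and dim: "DIM('e) = 2 * n + 1"
    and kenmotsu: "kenmotsu A \<phi> \<xi> \<eta> g nabla"
    and a: "a > 0"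
    and deformed: "(\<phi>', \<xi>', \<eta>', g') = D_homothetic a (\<phi>, \<xi>, \<eta>, g)"
    and soliton: "almost_riemann_soliton A g' nabla' V lam'"
    and solenoidal: "solenoidal A g nabla V"
  shows "(\<forall>p. lam' p =
            (2 * real n - 1) / (2 * real n) * \<xi> p (\<lambda>q. \<eta> q (V q)) - 1 / a\<^sup>2)
    \<and> (\<forall>X Y. vector_field A X \<longrightarrow> vector_field A Y \<longrightarrow> (\<forall>p.
         ricci A g nabla X Y p =
           ((2 * real n - 1) * a * \<xi> p (\<lambda>q. \<eta> q (V q)) - 2 * real n) * g p (X p) (Y p)
           + (2 * real n - 1) * a * (a - 1) * \<xi> p (\<lambda>q. \<eta> q (V q)) * \<eta> p (X p) * \<eta> p (Y p)
           - (2 * real n - 1) * a / 2 *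
               (g p (nabla X V p) (Y p) + g p (nabla Y V p) (X p))
           - (2 * real n - 1) * a * (a - 1) / 2 *
               (\<eta> p (X p) * (\<eta> p (nabla Y V p) + g p (Y p) (V p))
                + \<eta> p (Y p) * (\<eta> p (nabla X V p) + g p (X p) (V p))
                - 2 * \<eta> p (X p) * \<eta> p (Y p) * \<eta> p (V p))))
    \<and> (\<forall>p. scalar_curvature A g nabla p =
         (2 * real n + 1) * ((2 * real n - 1) * a * \<xi> p (\<lambda>q. \<eta> q (V q)) - 2 * real n))"
proof -
  interpret K: kenmotsu_manifold A \<phi> \<xi> \<eta> g nabla
    using kenmotsu by (rule kenmotsu_manifold.intro)
  have g': "g' = K.deformed_metric a"
    using deformed by (auto simp: D_homothetic_def K.deformed_metric_def fun_eq_iff)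
  interpret deformed_kenmotsu A \<phi> \<xi> \<eta> g nabla a nabla'
    using a soliton unfolding almost_riemann_soliton_def g' by unfold_locales auto
  have V: "vector_field A V" using soliton unfolding almost_riemann_soliton_def by blast
  have dim': "real DIM('e) = 2 * real n + 1" using dim by simp
  define s where "s p = \<xi> p (\<lambda>q. \<eta> q (V q))" for p
  define L where "L X Y p = 1 / 2 * lie_derivative_metric V (K.deformed_metric a) X Y p" for X Y p
  have L: "L X Y p = a / 2 * (g p (nabla X V p) (Y p) + g p (nabla Y V p) (X p))
      + a * (a - 1) / 2 * (\<eta> p (Y p) * X p (\<lambda>q. \<eta> q (V q)) + \<eta> p (X p) * Y p (\<lambda>q. \<eta> q (V q)))"
    if "vector_field A X" "vector_field A Y" for X Y p
    unfolding L_def by (rule deformed_lie_derivative[OF V that])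
  have ric: "ricci A g nabla X Y p = 2 * real n * lam' p * K.deformed_metric a p (X p) (Y p)
      - (2 * real n - 1) * L X Y p - 2 * real n * ((a - 1) / a) * K.transverse p (X p) (Y p)"
    if X: "vector_field A X" and Y: "vector_field A Y" for X Y p
  proof -
    have div: "divergence A g nabla V p = 0" using solenoidal unfolding solenoidal_def by blast
    have "ricci A g nabla X Y p =
        (real DIM('e) - 1) * lam' p * K.deformed_metric a p (X p) (Y p)
        - (real DIM('e) - 2) * (1 / 2 * lie_derivative_metric V (K.deformed_metric a) X Y p)
        - (real DIM('e) - 1) * ((a - 1) / a) * K.transverse p (X p) (Y p)"
      by (rule soliton_ricci[OF V div _ X Y])
        (use soliton in \<open>auto simp: almost_riemann_soliton_def g'\<close>)
    then show ?thesis unfolding dim' L_def by simp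
  qed

  have lam: "2 * real n * lam' p = (2 * real n - 1) * s p - 2 * real n / a\<^sup>2" for p
  proof -
    have "\<eta> p (nabla \<xi> V p) = s p"
      using K.eta_derivative[OF K.xi_field V, of p] K.transverse_xi(2)[OF K.tangent_field(1)[OF V]]
      by (simp add: s_def)
    then have "L \<xi> \<xi> p = a\<^sup>2 * s p"
      unfolding L[OF K.xi_field K.xi_field]
      by (simp add: K.eta_metric' K.tangent_field K.xi_field V K.eta_xi s_def[symmetric]
          power2_eq_square field_simps)
    \<comment> \<open>The Ricci tensor at \<open>(\<xi>,\<xi>)\<close> is known on every Kenmotsu manifold, which fixes \<open>lam'\<close>.\<close>
    then have "- (2 * real n) = 2 * real n * lam' p * a\<^sup>2 - (2 * real n - 1) * (a\<^sup>2 * s p)"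
      using ric[OF K.xi_field K.xi_field, of p] K.ricci_xi_xi[of p]
      by (simp add: dim' K.transverse_xi K.xi_tangent K.deformed_metric_def K.eta_metric K.eta_xi
          power2_eq_square algebra_simps)
    then show ?thesis using a by (simp add: field_simps)
  qed
  have "lam' p = (2 * real n - 1) / (2 * real n) * s p - 1 / a\<^sup>2" for p
    using lam[of p] n a by (simp add: field_simps)
  moreover have ric': "ricci A g nabla X Y p =
      ((2 * real n - 1) * a * s p - 2 * real n) * g p (X p) (Y p)
      + (2 * real n - 1) * a * (a - 1) * s p * \<eta> p (X p) * \<eta> p (Y p)
      - (2 * real n - 1) * L X Y p"
    if "vector_field A X" "vector_field A Y" for X Y p
    unfolding ric[OF that] lam K.deformed_metric_def K.transverse_def
    using a by (simp add: field_simps power2_eq_square)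
  moreover have "(2 * real n - 1) * L X Y p =
      (2 * real n - 1) * a / 2 * (g p (nabla X V p) (Y p) + g p (nabla Y V p) (X p))
      + (2 * real n - 1) * a * (a - 1) / 2 *
          (\<eta> p (X p) * (\<eta> p (nabla Y V p) + g p (Y p) (V p))
            + \<eta> p (Y p) * (\<eta> p (nabla X V p) + g p (X p) (V p))
            - 2 * \<eta> p (X p) * \<eta> p (Y p) * \<eta> p (V p))"
    if "vector_field A X" "vector_field A Y" for X Y p
  proof -
    have distrib: "k * (x / 2 * b + x * y / 2 * d) = k * x / 2 * b + k * x * y / 2 * d"
      for k x y b d :: real by (simp add: field_simps)
    show ?thesis
      unfolding L[OF that] distrib K.eta_derivative[OF that(1) V] K.eta_derivative[OF that(2) V]
        K.transverse_def by (simp add: algebra_simps)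
  qed
  moreover have "scalar_curvature A g nabla p =
      (2 * real n + 1) * ((2 * real n - 1) * a * s p - 2 * real n)" for p
  proof -
    obtain E where E: "orthonormal_at A g p E"
      and trace: "\<And>T. metric_trace A g T p = (\<Sum>i\<in>Basis. T (E i) (E i) p)"
      using K.metric_trace_orthonormal[of p] by blast
    have Ef: "vector_field A (E i)" and E1: "g p (E i p) (E i p) = 1" if "i \<in> Basis" for i
      using E that unfolding orthonormal_at_def by simp_all
    have eta: "(\<Sum>i\<in>Basis. \<eta> p (E i p) * F (E i p)) = F (\<xi> p)"
      if "linear_on_tangent_space A p F" for F :: "_ \<Rightarrow> real"
      using K.orthonormal_contraction[OF E that K.xi_tangent]
      by (simp add: K.eta_metric K.tangent_field Ef)
    have "divergence A g nabla V p = 0" using solenoidal unfolding solenoidal_def by blast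
    then have "(\<Sum>i\<in>Basis. g p (nabla (E i) V p) (E i p)) = 0"
      unfolding divergence_def trace on_fields_def .
    moreover have "(\<Sum>i\<in>Basis. \<eta> p (E i p) * E i p (\<lambda>q. \<eta> q (V q))) = s p"
      unfolding s_def by (rule eta) (simp add: linear_on_tangent_space_def scaleR_fun_def)
    moreover have "L (E i) (E i) p = a * g p (nabla (E i) V p) (E i p)
        + a * (a - 1) * (\<eta> p (E i p) * E i p (\<lambda>q. \<eta> q (V q)))" if "i \<in> Basis" for i
      unfolding L[OF Ef[OF that] Ef[OF that]] by (simp add: field_simps)
    ultimately have trL: "(\<Sum>i\<in>Basis. L (E i) (E i) p) = a * (a - 1) * s p"
      by (simp add: sum.distrib flip: sum_distrib_left)
    have "scalar_curvature A g nabla p = (\<Sum>i\<in>Basis. ((2 * real n - 1) * a * s p - 2 * real n)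
        + (2 * real n - 1) * a * (a - 1) * s p * (\<eta> p (E i p) * \<eta> p (E i p))
        - (2 * real n - 1) * L (E i) (E i) p)"
      unfolding scalar_curvature_def trace by (simp add: ric' Ef E1 mult.assoc)
    also have "\<dots> = real DIM('e) * ((2 * real n - 1) * a * s p - 2 * real n)
        + (2 * real n - 1) * a * (a - 1) * s p - (2 * real n - 1) * (a * (a - 1) * s p)"
      using eta[OF K.eta_linear]
      by (simp add: sum.distrib sum_subtractf trL K.eta_xi flip: sum_distrib_left)
    finally show ?thesis by (simp add: dim' mult.assoc)
  qed
  ultimately show ?thesis unfolding s_def by (simp add: diff_diff_eq)
qed

end
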